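(* Let $S$ be a finite inverse semigroup with $\mathcal{D}$-classes $D_0,\ldots,D_n$. Let $r_k$ denote the number of idempotents in $D_k$. For each $k$ choose an idempotent $e_k\in D_k$, and let $G_k$ be the maximal subgroup of $S$ at $e_k$. Then the number of operations required to compute the Fourier transform of an arbitrary $\mathbb{C}$-valued function on $S$ satisfies \[ \mathcal{C}(S)\;\leq\;\mathcal{C}(\zeta_S)+\sum_{k=0}^n r_k^2\,\mathcal{C}(G_k). \]
   Context: An inverse semigroup is a semigroup $S$ such that for each $x\in S$ there is a unique $y\in S$ (written $x^{-1}$) with $xyx=x$ and $yxy=y$. Idempotents $a,b\in S$ are isomorphic if there is $s\in S$ with $a=s^{-1}s$ and $b=ss^{-1}$. Green's relation: $s\mathrel{\mathcal{D}}t$ iff $s^{-1}s$ is isomorphic to $t^{-1}t$; its equivalence classes are the $\mathcal{D}$-classes of $S$. The maximal subgroup at an idempotent $e$ is $\{s\in S: s^{-1}s=ss^{-1}=e\}$. $\mathbb{C}S$ is the complex semigroup algebra with basis $\{s\}_{s\in S}$; a function $f:S\to\mathbb{C}$ is identified with $\sum_{s\in S}f(s)s$. A representation of $\mathbb{C}S$ of dimension $d_\rho$ is an algebra homomorphism $\rho:\mathbb{C}S\to M_{d_\rho}(\mathbb{C})$; it is irreducible if it is nonzero and simple as a left $\mathbb{C}S$-module; two representations are equivalent if they are conjugate by an invertible matrix. A complete set $\mathcal{Y}$ of inequivalent irreducible representations contains exactly one representation from each equivalence class of irreducible representations. The Fourier transform of $f$ relative to $\mathcal{Y}$ is $\bigoplus_{\rho\in\mathcal{Y}}\sum_{s\in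 S}f(s)\rho(s)\in\bigoplus_{\rho\in\mathcal{Y}}M_{d_\rho}(\mathbb{C})$. Complexity: an operation is a complex multiplication followed by a complex addition, i.e. the computation of $uv+z$ where each of $u,v,z$ is an input, a constant (such as an entry of a precomputed representation matrix), or the result of an earlier operation. Only operations are counted: copying, storing and rearranging numbers is free. $\mathcal{T}_{\mathcal{Y}}(S)$ is the maximum number of operations needed to compute the Fourier transform relative to $\mathcal{Y}$ of an arbitrary $f=\sum_{s}f(s)s$ (given by its values $f(s)$), all representations in $\mathcal{Y}$ being precomputed and stored, and $\mathcal{C}(S)=\min_{\mathcal{Y}}\mathcal{T}_{\mathcal{Y}}(S)$ over all complete sets $\mathcal{Y}$ of inequivalent irreducible representations of $\mathbb{C}S$. This applies in particular to finite groups. The natural partial order on $S$: $s\leq t$ iff $s=et$ for some idempotent $e\in S$. The zeta transform of $f$ on $S$ is the collection of numbers $g(s)=\sum_{t\in S:\,t\geq s}f(t)$, $s\in S$ (equivalently, the coefficients of $f$ in the groupoid basis $\lfloor s\rfloor=\sum_{t\leq s}\mu(t,s)t$, with $\mu$ the Möbius function of $(S,\leq)$). $\mathcal{C}(\zeta_S)$ is the maximum number of operations needed to compute the zeta transform of an arbitrary $f$ given its values $f(s)$. *)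

theory Defs
  imports Jordan_Normal_Form.VS_Connect "HOL-Library.Extended_Nat"
begin

section \<open>Inverse semigroups\<close>

text \<open>Semigroups are given by a carrier set and a binary operation, so that the maximal subgroups
  of a semigroup are semigroups in the same sense, under the same operation.\<close>

locale inverse_semigroup =
  fixes S :: "'a set" and mul :: "'a \<Rightarrow> 'a \<Rightarrow> 'a"
  assumes closed: "x \<in> S \<Longrightarrow> y \<in> S \<Longrightarrow> mul x y \<in> S"
    and assoc: "x \<in> S \<Longrightarrow> y \<in> S \<Longrightarrow> z \<in> S \<Longrightarrow> mul (mul x y) z = mul x (mul y z)"
    and ex1_inverse: "x \<in> S \<Longrightarrow> \<exists>!y. y \<in> S \<and> mul (mul x y) x = x \<and> mul (mul y x) y = y"

definition sinv :: "'a set \<Rightarrow> ('a \<Rightarrow> 'a \<Rightarrow> 'a) \<Rightarrow> 'a \<Rightarrow> 'a" where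
  "sinv S mul x = (THE y. y \<in> S \<and> mul (mul x y) x = x \<and> mul (mul y x) y = y)"

definition idempotents :: "'a set \<Rightarrow> ('a \<Rightarrow> 'a \<Rightarrow> 'a) \<Rightarrow> 'a set" where
  "idempotents S mul = {e \<in> S. mul e e = e}"

definition isomorphic_idempotents :: "'a set \<Rightarrow> ('a \<Rightarrow> 'a \<Rightarrow> 'a) \<Rightarrow> 'a \<Rightarrow> 'a \<Rightarrow> bool" where
  "isomorphic_idempotents S mul a b \<longleftrightarrow>
     a \<in> idempotents S mul \<and> b \<in> idempotents S mul \<and>
     (\<exists>s\<in>S. a = mul (sinv S mul s) s \<and> b = mul s (sinv S mul s))"

definition green_D :: "'a set \<Rightarrow> ('a \<Rightarrow> 'a \<Rightarrow> 'a) \<Rightarrow> 'a rel" where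
  "green_D S mul = {(s, t). s \<in> S \<and> t \<in> S \<and>
     isomorphic_idempotents S mul (mul (sinv S mul s) s) (mul (sinv S mul t) t)}"

definition D_classes :: "'a set \<Rightarrow> ('a \<Rightarrow> 'a \<Rightarrow> 'a) \<Rightarrow> 'a set set" where
  "D_classes S mul = S // green_D S mul"

definition maximal_subgroup :: "'a set \<Rightarrow> ('a \<Rightarrow> 'a \<Rightarrow> 'a) \<Rightarrow> 'a \<Rightarrow> 'a set" where
  "maximal_subgroup S mul e =
     {s \<in> S. mul (sinv S mul s) s = e \<and> mul s (sinv S mul s) = e}"

definition natural_le :: "'a set \<Rightarrow> ('a \<Rightarrow> 'a \<Rightarrow> 'a) \<Rightarrow> 'a \<Rightarrow> 'a \<Rightarrow> bool" where
  "natural_le S mul s t \<longleftrightarrow> (\<exists>e\<in>idempotents S mul. s = mul e t)"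

section \<open>The semigroup algebra and its representations\<close>

text \<open>An element of the algebra of a finite semigroup is a function that vanishes off the carrier;
  its product is convolution. The basis element of \<open>s\<close> is \<open>point_mass s\<close>.\<close>

definition semigroup_algebra :: "'a set \<Rightarrow> ('a \<Rightarrow> complex) set" where
  "semigroup_algebra S = {f. \<forall>s. s \<notin> S \<longrightarrow> f s = 0}"

definition point_mass :: "'a \<Rightarrow> 'a \<Rightarrow> complex" where
  "point_mass s = (\<lambda>t. if t = s then 1 else 0)"

definition convolution ::
    "'a set \<Rightarrow> ('a \<Rightarrow> 'a \<Rightarrow> 'a) \<Rightarrow> ('a \<Rightarrow> complex) \<Rightarrow> ('a \<Rightarrow> complex) \<Rightarrow> 'a \<Rightarrow> complex" where
  "convolution S mul f g = (\<lambda>s. \<Sum>(t, u)\<in>{(t, u). t \<in> S \<and> u \<in> S \<and> mul t u = s}. f t * g u)"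

definition representation ::
    "'a set \<Rightarrow> ('a \<Rightarrow> 'a \<Rightarrow> 'a) \<Rightarrow> nat \<Rightarrow> (('a \<Rightarrow> complex) \<Rightarrow> complex mat) \<Rightarrow> bool" where
  "representation S mul d \<rho> \<longleftrightarrow>
     (\<forall>f\<in>semigroup_algebra S. \<rho> f \<in> carrier_mat d d) \<and>
     (\<forall>f\<in>semigroup_algebra S. \<forall>g\<in>semigroup_algebra S. \<rho> (\<lambda>s. f s + g s) = \<rho> f + \<rho> g) \<and>
     (\<forall>c. \<forall>f\<in>semigroup_algebra S. \<rho> (\<lambda>s. c * f s) = c \<cdot>\<^sub>m \<rho> f) \<and>
     (\<forall>f\<in>semigroup_algebra S. \<forall>g\<in>semigroup_algebra S. \<rho> (convolution S mul f g) = \<rho> f * \<rho> g)"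

text \<open>Homomorphisms are not required to be unital; the nonzero condition below excludes the zero
  representations, in particular the one of dimension 0. A submodule for the algebra is a linear
  subspace that is stable under the action.\<close>

definition irreducible_representation ::
    "'a set \<Rightarrow> ('a \<Rightarrow> 'a \<Rightarrow> 'a) \<Rightarrow> nat \<Rightarrow> (('a \<Rightarrow> complex) \<Rightarrow> complex mat) \<Rightarrow> bool" where
  "irreducible_representation S mul d \<rho> \<longleftrightarrow>
     representation S mul d \<rho> \<and>
     (\<exists>f\<in>semigroup_algebra S. \<rho> f \<noteq> 0\<^sub>m d d) \<and>
     (\<forall>W. submodule class_ring W (module_vec TYPE(complex) d) \<and>
          (\<forall>f\<in>semigroup_algebra S. \<forall>w\<in>W. \<rho> f *\<^sub>v w \<in> W)
          \<longrightarrow> W = {0\<^sub>v d} \<or> W = carrier_vec d)"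

definition equivalent_representations ::
    "'a set \<Rightarrow> nat \<times> (('a \<Rightarrow> complex) \<Rightarrow> complex mat) \<Rightarrow>
     nat \<times> (('a \<Rightarrow> complex) \<Rightarrow> complex mat) \<Rightarrow> bool" where
  "equivalent_representations S = (\<lambda>(d, \<rho>) (d', \<rho>').
     d = d' \<and> (\<exists>P Q. \<forall>f\<in>semigroup_algebra S. similar_mat_wit (\<rho> f) (\<rho>' f) P Q))"

definition complete_irreducibles ::
    "'a set \<Rightarrow> ('a \<Rightarrow> 'a \<Rightarrow> 'a) \<Rightarrow> (nat \<times> (('a \<Rightarrow> complex) \<Rightarrow> complex mat)) set \<Rightarrow> bool" where
  "complete_irreducibles S mul Y \<longleftrightarrow>
     (\<forall>(d, \<rho>)\<in>Y. irreducible_representation S mul d \<rho>) \<and>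
     (\<forall>d \<rho>. irreducible_representation S mul d \<rho> \<longrightarrow>
        (\<exists>!y. y \<in> Y \<and> equivalent_representations S (d, \<rho>) y))"

section \<open>Operation counts\<close>

text \<open>Straight-line programs over the complex numbers. Every operation computes \<open>u * v + w\<close>; the
  \<open>m\<close>-th one may use inputs, constants and the results of operations with index below \<open>m\<close>. The
  program and its constants are fixed before the input is known. Reading off the outputs, which
  may be inputs, constants or results, is free.\<close>

datatype 'i operand = Input 'i | Const complex | Result nat

type_synonym 'i operation = "'i operand \<times> 'i operand \<times> 'i operand"

primrec available :: "'i set \<Rightarrow> nat \<Rightarrow> 'i operand \<Rightarrow> bool" where
  "available I m (Input i) \<longleftrightarrow> i \<in> I"
| "available I m (Const c) \<longleftrightarrow> True"
| "available I m (Result j) \<longleftrightarrow> j < m"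

primrec operand_value :: "('i \<Rightarrow> complex) \<Rightarrow> complex list \<Rightarrow> 'i operand \<Rightarrow> complex" where
  "operand_value x rs (Input i) = x i"
| "operand_value x rs (Const c) = c"
| "operand_value x rs (Result j) = rs ! j"

definition straight_line_program :: "'i set \<Rightarrow> 'i operation list \<Rightarrow> bool" where
  "straight_line_program I p \<longleftrightarrow>
     (\<forall>m<length p. case p ! m of (u, v, w) \<Rightarrow> available I m u \<and> available I m v \<and> available I m w)"

definition run_program :: "('i \<Rightarrow> complex) \<Rightarrow> 'i operation list \<Rightarrow> complex list" where
  "run_program x p =
     foldl (\<lambda>rs (u, v, w).
       rs @ [operand_value x rs u * operand_value x rs v + operand_value x rs w]) [] p"

text \<open>\<open>F x j\<close> is the output with index \<open>j \<in> J\<close> on the input values \<open>x i\<close>, \<open>i \<in> I\<close>.\<close>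

definition computes ::
    "'i set \<Rightarrow> 'j set \<Rightarrow> (('i \<Rightarrow> complex) \<Rightarrow> 'j \<Rightarrow> complex) \<Rightarrow> 'i operation list \<Rightarrow> bool" where
  "computes I J F p \<longleftrightarrow> straight_line_program I p \<and>
     (\<exists>out. \<forall>j\<in>J. available I (length p) (out j) \<and>
        (\<forall>x. operand_value x (run_program x p) (out j) = F x j))"

text \<open>Minima are taken in the extended naturals, where the infimum of the empty set is \<open>\<infinity>\<close>:
  no junk value arises if nothing computes the outputs.\<close>

definition operation_count ::
    "'i set \<Rightarrow> 'j set \<Rightarrow> (('i \<Rightarrow> complex) \<Rightarrow> 'j \<Rightarrow> complex) \<Rightarrow> enat" where
  "operation_count I J F = (INF p\<in>{p. computes I J F p}. enat (length p))"

section \<open>Complexity of the Fourier and zeta transforms\<close>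

definition fourier_transform ::
    "'a set \<Rightarrow> ('a \<Rightarrow> complex) \<Rightarrow> nat \<times> (('a \<Rightarrow> complex) \<Rightarrow> complex mat) \<Rightarrow> complex mat" where
  "fourier_transform S f = (\<lambda>(d, \<rho>). mat d d (\<lambda>(i, j). \<Sum>s\<in>S. f s * \<rho> (point_mass s) $$ (i, j)))"

definition fourier_complexity_wrt ::
    "'a set \<Rightarrow> (nat \<times> (('a \<Rightarrow> complex) \<Rightarrow> complex mat)) set \<Rightarrow> enat" where
  "fourier_complexity_wrt S Y =
     operation_count S {(y, i, j). y \<in> Y \<and> i < fst y \<and> j < fst y}
       (\<lambda>f (y, i, j). fourier_transform S f y $$ (i, j))"

definition fourier_complexity :: "'a set \<Rightarrow> ('a \<Rightarrow> 'a \<Rightarrow> 'a) \<Rightarrow> enat" where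
  "fourier_complexity S mul =
     (INF Y\<in>{Y. complete_irreducibles S mul Y}. fourier_complexity_wrt S Y)"

definition zeta_transform ::
    "'a set \<Rightarrow> ('a \<Rightarrow> 'a \<Rightarrow> 'a) \<Rightarrow> ('a \<Rightarrow> complex) \<Rightarrow> 'a \<Rightarrow> complex" where
  "zeta_transform S mul f s = (\<Sum>t\<in>{t \<in> S. natural_le S mul s t}. f t)"

definition zeta_complexity :: "'a set \<Rightarrow> ('a \<Rightarrow> 'a \<Rightarrow> 'a) \<Rightarrow> enat" where
  "zeta_complexity S mul = operation_count S S (zeta_transform S mul)"

end

theory Submission
  imports Defs
begin

text \<open>Let \<open>e\<close> be an idempotent with maximal subgroup \<open>G\<close>, and let \<open>p i\<close>, \<open>i < r\<close>, be elements with
  domain \<open>e\<close> whose ranges are the idempotents isomorphic to \<open>e\<close>. A representation of \<open>G\<close> induces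
  a representation of the semigroup on \<open>r\<close> copies of its space: the block of \<open>t\<close> at \<open>(i, j)\<close> is the
  image of \<open>(p i)\<inverse> t (p j)\<close> if this element lies in \<open>G\<close>, and zero otherwise. Since
  \<open>(p i)\<inverse> t (p j) = h\<close> means that \<open>p i h (p j)\<inverse> \<le> t\<close>, the \<open>(i, j)\<close> block of the Fourier transform
  of \<open>f\<close> is the Fourier transform over \<open>G\<close> of \<open>h \<mapsto> (\<zeta> f) (p i h (p j)\<inverse>)\<close>. So one zeta transform
  followed by \<open>r\<^sup>2\<close> Fourier transforms over \<open>G\<close> per class suffices, once the induced representations
  form a complete set. An irreducible \<open>\<sigma>\<close> is recovered from a minimal idempotent \<open>e\<close> with
  \<open>\<sigma> e \<noteq> 0\<close>: the image of \<open>\<sigma> e\<close> is an irreducible representation of \<open>G\<close>, and Schur's lemma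
  identifies \<open>\<sigma>\<close> with the representation induced from it.\<close>

section \<open>Composition of straight-line programs\<close>

text \<open>One could decompose the semigroup algebra into matrix algebras over group algebras by
  Moebius inversion. The proof avoids this: the blocks of the induced representations already
  evaluate the zeta transform, so what has to be shown is completeness. Completeness asks for
  exactly one member per equivalence class. So the induced representations must be irreducible, an
  equivalence between two of them must force the same D-class and an equivalence over the group, and
  every irreducible must be reached. Finiteness makes the blocks behave well. No idempotent
  isomorphic to \<open>e\<close> lies strictly below \<open>e\<close>, hence
  \<open>p i h (p j)\<inverse>\<close> has a single nonzero block, like a matrix unit. The same
  count picks the idempotent for a given irreducible: where it is least among idempotents with
  nonzero image, every element with a domain of smaller rank acts as zero, and these zeros are the
  zero blocks of the induced representation. The bound has no extra term because the group programs
  read zeta values under new names, and renaming operands is free.\<close>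

definition computable :: "'i set \<Rightarrow> 'i operation list \<Rightarrow> (('i \<Rightarrow> complex) \<Rightarrow> complex) \<Rightarrow> bool" where
  "computable I P \<phi> \<longleftrightarrow>
     (\<exists>a. available I (length P) a \<and> (\<forall>x. operand_value x (run_program x P) a = \<phi> x))"

lemma computes_iff:
  "computes I J F P \<longleftrightarrow>
     straight_line_program I P \<and> (\<forall>j\<in>J. computable I P (\<lambda>x. F x j))"
  unfolding computes_def computable_def by metis

text \<open>\<open>m\<close> is the length of the program already run: the results of the appended
  program are renumbered from \<open>m\<close> on, and \<open>\<sigma>\<close> names the operand
  that already holds each of its inputs. Only operands are renamed, so connecting two programs adds
  no operation.\<close>

fun substitute :: "nat \<Rightarrow> ('i \<Rightarrow> 'j operand) \<Rightarrow> 'i operand \<Rightarrow> 'j operand" where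
  "substitute m \<sigma> (Input i) = \<sigma> i"
| "substitute m \<sigma> (Const c) = Const c"
| "substitute m \<sigma> (Result j) = Result (m + j)"

definition substitute_program ::
    "nat \<Rightarrow> ('i \<Rightarrow> 'j operand) \<Rightarrow> 'i operation list \<Rightarrow> 'j operation list" where
  "substitute_program m \<sigma> =
     map (\<lambda>(u, v, w). (substitute m \<sigma> u, substitute m \<sigma> v, substitute m \<sigma> w))"

lemma length_substitute_program [simp]: "length (substitute_program m \<sigma> P) = length P"
  by (simp add: substitute_program_def)

lemma run_program_snoc:
  "run_program x (P @ [(u, v, w)]) = run_program x P @
     [operand_value x (run_program x P) u * operand_value x (run_program x P) v
       + operand_value x (run_program x P) w]"
  by (simp add: run_program_def)

lemma length_run_program [simp]: "length (run_program x P) = length P"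
  by (induction P rule: rev_induct) (auto simp: run_program_snoc, simp add: run_program_def)

lemma slp_snoc:
  "straight_line_program I (P @ [(u, v, w)]) \<longleftrightarrow> straight_line_program I P \<and>
     available I (length P) u \<and> available I (length P) v \<and> available I (length P) w"
  unfolding straight_line_program_def by (auto simp: nth_append less_Suc_eq)

lemma available_mono: "available I m a \<Longrightarrow> m \<le> m' \<Longrightarrow> available I m' a"
  by (cases a) auto

lemma operand_value_append:
  "available I (length rs) a \<Longrightarrow> operand_value x (rs @ rs') a = operand_value x rs a"
  by (cases a) (auto simp: nth_append)

lemma run_program_prefix: "\<exists>rs. run_program x (P @ Q) = run_program x P @ rs"
proof (induction Q rule: rev_induct)
  case (snoc q Q)
  obtain u v w where "q = (u, v, w)" by (cases q)
  thus ?case using run_program_snoc[of x "P @ Q" u v w] snoc.IH by auto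
qed auto

lemma computable_append: "computable I P \<phi> \<Longrightarrow> computable I (P @ Q) \<phi>"
  unfolding computable_def
  by (metis available_mono le_add1 length_append length_run_program operand_value_append
      run_program_prefix)

context
  fixes I :: "'i set" and P :: "'i operation list" and K :: "'k set"
    and \<sigma> :: "'k \<Rightarrow> 'i operand" and F :: "'k \<Rightarrow> ('i \<Rightarrow> complex) \<Rightarrow> complex"
  assumes \<sigma>: "\<And>k. k \<in> K \<Longrightarrow> available I (length P) (\<sigma> k)"
    and F: "\<And>k x. k \<in> K \<Longrightarrow> operand_value x (run_program x P) (\<sigma> k) = F k x"
begin

text \<open>The offset \<open>length P\<close> skips the results of \<open>P\<close>, so
  \<open>Result\<close> operands hit the entries of \<open>rs\<close>. An input \<open>k\<close> is
  read from \<open>P\<close> and thus has the value \<open>F k x\<close>.\<close>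

lemma operand_value_substitute:
  assumes "available K (length rs) a"
  shows "operand_value x (run_program x P @ rs) (substitute (length P) \<sigma> a)
    = operand_value (\<lambda>k. F k x) rs a"
proof (cases a)
  case (Input k)
  hence k: "k \<in> K" using assms by simp
  have "operand_value x (run_program x P @ rs) (\<sigma> k) = operand_value x (run_program x P) (\<sigma> k)"
    by (rule operand_value_append[of I]) (simp add: \<sigma> k)
  thus ?thesis using Input F[OF k] by simp
qed (use assms in \<open>auto simp: nth_append\<close>)

lemma run_program_substitute:
  assumes "straight_line_program K Q"
  shows "run_program x (P @ substitute_program (length P) \<sigma> Q)
    = run_program x P @ run_program (\<lambda>k. F k x) Q"
  using assms
proof (induction Q rule: rev_induct)
  case (snoc q Q)
  obtain u v w where q: "q = (u, v, w)" by (cases q)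
  let ?s = "substitute (length P) \<sigma>"
  have "P @ substitute_program (length P) \<sigma> (Q @ [q])
      = (P @ substitute_program (length P) \<sigma> Q) @ [(?s u, ?s v, ?s w)]"
    by (simp add: substitute_program_def q)
  thus ?case using snoc unfolding q slp_snoc
    by (simp add: run_program_snoc operand_value_substitute del: append_assoc)
qed (simp add: substitute_program_def run_program_def)

lemma available_substitute:
  "available K m a \<Longrightarrow> available I (length P + m) (substitute (length P) \<sigma> a)"
  by (cases a) (auto intro: available_mono[OF \<sigma>])

lemma slp_substitute:
  assumes "straight_line_program I P" "straight_line_program K Q"
  shows "straight_line_program I (P @ substitute_program (length P) \<sigma> Q)"
  using assms(2)
proof (induction Q rule: rev_induct)
  case (snoc q Q)
  obtain u v w where q: "q = (u, v, w)" by (cases q)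
  let ?s = "substitute (length P) \<sigma>"
  have "P @ substitute_program (length P) \<sigma> (Q @ [q])
      = (P @ substitute_program (length P) \<sigma> Q) @ [(?s u, ?s v, ?s w)]"
    by (simp add: substitute_program_def q)
  thus ?case using snoc unfolding q slp_snoc
    by (simp add: slp_snoc available_substitute del: append_assoc)
qed (simp add: substitute_program_def assms(1))

end

text \<open>Besides the composed outputs, everything that \<open>P\<close> made available survives
  in \<open>R\<close>. This allows several programs to read the values of \<open>P\<close> one after
  another.\<close>

lemma compose_programs:
  assumes P: "straight_line_program I P" and Q: "straight_line_program K Q"
    and F: "\<And>k. k \<in> K \<Longrightarrow> computable I P (F k)"
  obtains R where "straight_line_program I R" "length R = length P + length Q"
    "\<And>\<phi>. computable I P \<phi> \<Longrightarrow> computable I R \<phi>"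
    "\<And>\<phi>. computable K Q \<phi> \<Longrightarrow> computable I R (\<lambda>x. \<phi> (\<lambda>k. F k x))"
proof -
  obtain \<sigma> where \<sigma>: "\<And>k. k \<in> K \<Longrightarrow> available I (length P) (\<sigma> k)"
    and F': "\<And>k x. k \<in> K \<Longrightarrow> operand_value x (run_program x P) (\<sigma> k) = F k x"
    using F unfolding computable_def by metis
  let ?R = "P @ substitute_program (length P) \<sigma> Q"
  have R: "straight_line_program I ?R" by (rule slp_substitute[OF \<sigma> F' P Q])
  have "computable I ?R (\<lambda>x. \<phi> (\<lambda>k. F k x))" if c: "computable K Q \<phi>" for \<phi>
  proof -
    obtain a where a: "available K (length Q) a"
      and v: "\<And>x. operand_value x (run_program x Q) a = \<phi> x"
      using c unfolding computable_def by blast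
    have "available I (length ?R) (substitute (length P) \<sigma> a)"
      using available_substitute[OF \<sigma> F' a] by simp
    moreover have "operand_value x (run_program x ?R) (substitute (length P) \<sigma> a)
        = \<phi> (\<lambda>k. F k x)" for x
    proof -
      have "run_program x ?R = run_program x P @ run_program (\<lambda>k. F k x) Q"
        by (rule run_program_substitute[OF \<sigma> F' Q])
      moreover have "operand_value x (run_program x P @ run_program (\<lambda>k. F k x) Q)
          (substitute (length P) \<sigma> a) = operand_value (\<lambda>k. F k x) (run_program (\<lambda>k. F k x) Q) a"
        using a by (intro operand_value_substitute[of K, OF \<sigma> F']) auto
      ultimately show ?thesis by (simp add: v)
    qed
    ultimately show ?thesis unfolding computable_def by blast
  qed
  thus ?thesis using that[of ?R] R computable_append by (metis length_append length_substitute_program)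
qed

text \<open>The programs \<open>Q c\<close> read values of \<open>P\<close> and never each other's
  results, so the induction only has to carry along the outputs of \<open>P\<close>. In the
  application \<open>P\<close> is the zeta transform and each \<open>Q c\<close> a Fourier transform
  over a group.\<close>

lemma compose_program_family:
  assumes P: "straight_line_program I P" and "finite C"
    and "\<And>c. c \<in> C \<Longrightarrow> straight_line_program (K c) (Q c)"
    and "\<And>c k. c \<in> C \<Longrightarrow> k \<in> K c \<Longrightarrow> computable I P (F c k)"
  shows "\<exists>R. straight_line_program I R \<and> length R = length P + (\<Sum>c\<in>C. length (Q c)) \<and>
    (\<forall>\<phi>. computable I P \<phi> \<longrightarrow> computable I R \<phi>) \<and>
    (\<forall>c\<in>C. \<forall>\<phi>. computable (K c) (Q c) \<phi> \<longrightarrow> computable I R (\<lambda>x. \<phi> (\<lambda>k. F c k x)))"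
  using assms(2-4)
proof (induction C rule: finite_induct)
  case empty
  thus ?case using P by auto
next
  case (insert c C)
  obtain R where R: "straight_line_program I R" "length R = length P + (\<Sum>c\<in>C. length (Q c))"
    "\<And>\<phi>. computable I P \<phi> \<Longrightarrow> computable I R \<phi>"
    "\<And>c \<phi>. c \<in> C \<Longrightarrow> computable (K c) (Q c) \<phi> \<Longrightarrow> computable I R (\<lambda>x. \<phi> (\<lambda>k. F c k x))"
    using insert by (metis insert_iff)
  obtain R' where R': "straight_line_program I R'" "length R' = length R + length (Q c)"
    "\<And>\<phi>. computable I R \<phi> \<Longrightarrow> computable I R' \<phi>"
    "\<And>\<phi>. computable (K c) (Q c) \<phi> \<Longrightarrow> computable I R' (\<lambda>x. \<phi> (\<lambda>k. F c k x))"
    using compose_programs[of I R "K c" "Q c" "F c"] R insert.prems by (metis insertI1)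
  show ?case using R R' insert.hyps by (intro exI[of _ R']) auto
qed

text \<open>The extended naturals are well-ordered, so only the empty set could fail, and its
  infimum is \<open>\<infinity>\<close>.\<close>

lemma Inf_enat_attained:
  fixes A :: "enat set"
  assumes "Inf A \<noteq> \<infinity>"
  shows "Inf A \<in> A"
proof -
  have "A \<noteq> {}" using assms by (auto simp: top_enat_def)
  thus ?thesis by (metis ex_in_conv wellorder_InfI)
qed

lemma operation_count_le: "computes I J F P \<Longrightarrow> operation_count I J F \<le> enat (length P)"
  unfolding operation_count_def by (rule INF_lower) simp

lemma operation_count_attained:
  assumes "operation_count I J F \<noteq> \<infinity>"
  obtains P where "computes I J F P" "operation_count I J F = enat (length P)"
  using Inf_enat_attained[OF assms[unfolded operation_count_def]]
  by (auto simp flip: operation_count_def)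

section \<open>Inverse semigroups\<close>

context inverse_semigroup
begin

abbreviation mul_infix (infixl "\<cdot>" 70) where "x \<cdot> y \<equiv> mul x y"
abbreviation inv_elem ("(_\<^sup>\<star>)" [1000] 1000) where "x\<^sup>\<star> \<equiv> sinv S mul x"
abbreviation "E \<equiv> idempotents S mul"

declare closed [simp, intro]

lemma inverse_props:
  assumes "x \<in> S"
  shows inv_closed [simp, intro]: "x\<^sup>\<star> \<in> S"
    and mul_inv_mul: "x \<cdot> x\<^sup>\<star> \<cdot> x = x" and inv_mul_inv: "x\<^sup>\<star> \<cdot> x \<cdot> x\<^sup>\<star> = x\<^sup>\<star>"
  using theI'[OF ex1_inverse[OF assms]] unfolding sinv_def by auto

lemma inv_unique:
  assumes "x \<in> S" "y \<in> S" "x \<cdot> y \<cdot> x = x" "y \<cdot> x \<cdot> y = y"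
  shows "x\<^sup>\<star> = y"
  using ex1_inverse[OF assms(1)] inverse_props[OF assms(1)] assms by blast

lemma inv_inv [simp]: "x \<in> S \<Longrightarrow> x\<^sup>\<star>\<^sup>\<star> = x"
  by (intro inv_unique inv_closed mul_inv_mul inv_mul_inv)

lemma idem_in: "a \<in> E \<Longrightarrow> a \<in> S" and idem_idem: "a \<in> E \<Longrightarrow> a \<cdot> a = a"
  and idemI: "a \<in> S \<Longrightarrow> a \<cdot> a = a \<Longrightarrow> a \<in> E"
  by (auto simp: idempotents_def)

lemma inv_idem: "a \<in> E \<Longrightarrow> a\<^sup>\<star> = a"
  by (rule inv_unique) (auto simp: idem_in idem_idem)

lemma dom_idem: "x \<in> S \<Longrightarrow> x\<^sup>\<star> \<cdot> x \<in> E" and ran_idem: "x \<in> S \<Longrightarrow> x \<cdot> x\<^sup>\<star> \<in> E"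
  by (auto intro!: idemI simp: inv_mul_inv mul_inv_mul simp flip: assoc)

lemma idem_left: "a \<in> E \<Longrightarrow> z \<in> S \<Longrightarrow> a \<cdot> (a \<cdot> z) = a \<cdot> z"
  by (simp add: idem_in idem_idem flip: assoc)

text \<open>With \<open>x\<close> the inverse of \<open>a \<cdot> b\<close>, the element
  \<open>b \<cdot> x \<cdot> a\<close> is an inverse as well, hence equal to \<open>x\<close>. This
  form of \<open>x\<close> shows \<open>x \<cdot> x = x\<close>. An idempotent is its own inverse,
  so \<open>a \<cdot> b = x\<close>.\<close>

lemma idem_mul_idem:
  assumes a: "a \<in> E" and b: "b \<in> E"
  shows "a \<cdot> b \<in> E"
proof -
  have S [simp]: "a \<in> S" "b \<in> S" using a b by (auto simp: idem_in)
  define x where "x = (a \<cdot> b)\<^sup>\<star>"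
  have x [simp]: "x \<in> S" unfolding x_def by simp
  have x1: "a \<cdot> b \<cdot> x \<cdot> (a \<cdot> b) = a \<cdot> b" and x2: "x \<cdot> (a \<cdot> b) \<cdot> x = x"
    unfolding x_def by (auto simp: mul_inv_mul inv_mul_inv)
  have "(a \<cdot> b)\<^sup>\<star> = b \<cdot> x \<cdot> a"
  proof (rule inv_unique)
    have "a \<cdot> b \<cdot> (b \<cdot> x \<cdot> a) \<cdot> (a \<cdot> b) = a \<cdot> b \<cdot> x \<cdot> (a \<cdot> b)"
      by (simp add: assoc idem_left a b)
    thus "a \<cdot> b \<cdot> (b \<cdot> x \<cdot> a) \<cdot> (a \<cdot> b) = a \<cdot> b" using x1 by simp
    have "b \<cdot> x \<cdot> a \<cdot> (a \<cdot> b) \<cdot> (b \<cdot> x \<cdot> a) = b \<cdot> (x \<cdot> (a \<cdot> b) \<cdot> x) \<cdot> a"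
      by (simp add: assoc idem_left a b)
    thus "b \<cdot> x \<cdot> a \<cdot> (a \<cdot> b) \<cdot> (b \<cdot> x \<cdot> a) = b \<cdot> x \<cdot> a" using x2 by simp
  qed auto
  hence xe: "x = b \<cdot> x \<cdot> a" unfolding x_def .
  have "x \<cdot> x = (b \<cdot> x \<cdot> a) \<cdot> (b \<cdot> x \<cdot> a)" using xe by simp
  also have "\<dots> = b \<cdot> (x \<cdot> (a \<cdot> b) \<cdot> x) \<cdot> a" by (simp add: assoc)
  also have "\<dots> = x" using x2 xe by simp
  finally have "x \<in> E" by (simp add: idemI)
  moreover from this have "a \<cdot> b = x" using inv_idem[of x] inv_inv[of "a \<cdot> b"] by (simp add: x_def)
  ultimately show ?thesis by simp
qed

text \<open>Both \<open>a \<cdot> b\<close> and \<open>b \<cdot> a\<close> are idempotent, which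
  makes each an inverse of the other; but the inverse of the idempotent \<open>a \<cdot> b\<close>
  is itself.\<close>

lemma idem_commute:
  assumes a: "a \<in> E" and b: "b \<in> E"
  shows "a \<cdot> b = b \<cdot> a"
proof -
  have S [simp]: "a \<in> S" "b \<in> S" using a b by (auto simp: idem_in)
  have "(a \<cdot> b)\<^sup>\<star> = b \<cdot> a"
  proof (rule inv_unique)
    show "a \<cdot> b \<cdot> (b \<cdot> a) \<cdot> (a \<cdot> b) = a \<cdot> b"
      using idem_idem[OF idem_mul_idem[OF a b]] by (simp add: assoc idem_left a b)
    show "b \<cdot> a \<cdot> (a \<cdot> b) \<cdot> (b \<cdot> a) = b \<cdot> a"
      using idem_idem[OF idem_mul_idem[OF b a]] by (simp add: assoc idem_left a b)
  qed auto
  thus ?thesis using inv_idem[OF idem_mul_idem[OF a b]] by simp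
qed

lemma inv_mul:
  assumes x [simp]: "x \<in> S" and y [simp]: "y \<in> S"
  shows "(x \<cdot> y)\<^sup>\<star> = y\<^sup>\<star> \<cdot> x\<^sup>\<star>"
proof (rule inv_unique)
  have c: "(y \<cdot> y\<^sup>\<star>) \<cdot> (x\<^sup>\<star> \<cdot> x) = (x\<^sup>\<star> \<cdot> x) \<cdot> (y \<cdot> y\<^sup>\<star>)"
    by (intro idem_commute ran_idem dom_idem x y)
  have "x \<cdot> y \<cdot> (y\<^sup>\<star> \<cdot> x\<^sup>\<star>) \<cdot> (x \<cdot> y) = x \<cdot> ((y \<cdot> y\<^sup>\<star>) \<cdot> (x\<^sup>\<star> \<cdot> x)) \<cdot> y"
    by (simp add: assoc)
  also have "\<dots> = (x \<cdot> x\<^sup>\<star> \<cdot> x) \<cdot> (y \<cdot> y\<^sup>\<star> \<cdot> y)" unfolding c by (simp add: assoc)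
  finally show "x \<cdot> y \<cdot> (y\<^sup>\<star> \<cdot> x\<^sup>\<star>) \<cdot> (x \<cdot> y) = x \<cdot> y" by (simp add: mul_inv_mul)
  have "y\<^sup>\<star> \<cdot> x\<^sup>\<star> \<cdot> (x \<cdot> y) \<cdot> (y\<^sup>\<star> \<cdot> x\<^sup>\<star>) = y\<^sup>\<star> \<cdot> ((x\<^sup>\<star> \<cdot> x) \<cdot> (y \<cdot> y\<^sup>\<star>)) \<cdot> x\<^sup>\<star>"
    by (simp add: assoc)
  also have "\<dots> = (y\<^sup>\<star> \<cdot> y \<cdot> y\<^sup>\<star>) \<cdot> (x\<^sup>\<star> \<cdot> x \<cdot> x\<^sup>\<star>)" unfolding c[symmetric] by (simp add: assoc)
  finally show "y\<^sup>\<star> \<cdot> x\<^sup>\<star> \<cdot> (x \<cdot> y) \<cdot> (y\<^sup>\<star> \<cdot> x\<^sup>\<star>) = y\<^sup>\<star> \<cdot> x\<^sup>\<star>" by (simp add: inv_mul_inv)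
qed auto

lemma mul_inv_left: "x \<in> S \<Longrightarrow> z \<in> S \<Longrightarrow> x \<cdot> (x\<^sup>\<star> \<cdot> (x \<cdot> z)) = x \<cdot> z"
  and inv_mul_left: "x \<in> S \<Longrightarrow> z \<in> S \<Longrightarrow> x\<^sup>\<star> \<cdot> (x \<cdot> (x\<^sup>\<star> \<cdot> z)) = x\<^sup>\<star> \<cdot> z"
  and mul_inv_right: "x \<in> S \<Longrightarrow> x \<cdot> (x\<^sup>\<star> \<cdot> x) = x"
  and inv_mul_right: "x \<in> S \<Longrightarrow> x\<^sup>\<star> \<cdot> (x \<cdot> x\<^sup>\<star>) = x\<^sup>\<star>"
  by (simp_all add: mul_inv_mul inv_mul_inv flip: assoc)

lemmas cancel = mul_inv_left inv_mul_left mul_inv_right inv_mul_right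

text \<open>An idempotent moves to the other side of \<open>x\<close> at the price of a conjugation.
  With \<open>conj_idem\<close> this turns a restriction on the right into the left multiplication
  by which \<open>natural_le\<close> is defined.\<close>

lemma swap_right:
  assumes [simp]: "x \<in> S" and a: "a \<in> E"
  shows "x \<cdot> a = (x \<cdot> a \<cdot> x\<^sup>\<star>) \<cdot> x"
proof -
  have [simp]: "a \<in> S" using a by (rule idem_in)
  have "(x \<cdot> a \<cdot> x\<^sup>\<star>) \<cdot> x = x \<cdot> (a \<cdot> (x\<^sup>\<star> \<cdot> x))" by (simp add: assoc)
  also have "\<dots> = x \<cdot> ((x\<^sup>\<star> \<cdot> x) \<cdot> a)" by (simp add: idem_commute[OF a] dom_idem)
  finally show ?thesis by (simp add: cancel assoc)
qed

lemma conj_idem: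
  assumes [simp]: "x \<in> S" and a: "a \<in> E"
  shows "x \<cdot> a \<cdot> x\<^sup>\<star> \<in> E"
proof (rule idemI)
  have [simp]: "a \<in> S" using a by (rule idem_in)
  show "x \<cdot> a \<cdot> x\<^sup>\<star> \<in> S" by simp
  have "x \<cdot> a \<cdot> x\<^sup>\<star> \<cdot> (x \<cdot> a \<cdot> x\<^sup>\<star>) = ((x \<cdot> a \<cdot> x\<^sup>\<star>) \<cdot> x) \<cdot> a \<cdot> x\<^sup>\<star>" by (simp add: assoc)
  also have "\<dots> = x \<cdot> a \<cdot> x\<^sup>\<star>" using a
    by (subst swap_right[symmetric]) (simp_all add: assoc idem_left)
  finally show "x \<cdot> a \<cdot> x\<^sup>\<star> \<cdot> (x \<cdot> a \<cdot> x\<^sup>\<star>) = x \<cdot> a \<cdot> x\<^sup>\<star>" .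
qed

text \<open>The domain \<open>e\<close> of \<open>f \<cdot> y\<close> lies below the domain of
  \<open>y\<close>, which lies below \<open>e\<close> because of \<open>y \<cdot> e = y\<close>. So
  \<open>f\<close> cuts nothing off \<open>y\<close>.\<close>

lemma idem_mul_eq:
  assumes [simp]: "y \<in> S" and f: "f \<in> E" and e: "(f \<cdot> y)\<^sup>\<star> \<cdot> (f \<cdot> y) = e" "y \<cdot> e = y"
  shows "f \<cdot> y = y"
proof -
  have [simp]: "f \<in> S" using f by (rule idem_in)
  have "y = y \<cdot> ((f \<cdot> y)\<^sup>\<star> \<cdot> (f \<cdot> y))" using e by simp
  also have "\<dots> = ((y \<cdot> y\<^sup>\<star>) \<cdot> f) \<cdot> y" by (simp add: inv_mul inv_idem f assoc idem_left)
  also have "\<dots> = f \<cdot> y"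
    by (subst idem_commute[OF ran_idem f]) (simp_all add: assoc cancel)
  finally show ?thesis by simp
qed

text \<open>Finiteness enters through this count: it is constant on isomorphic idempotents and strictly
  monotone, so no idempotent is isomorphic to one strictly below it.\<close>

definition rank :: "'a \<Rightarrow> nat" where "rank a = card {f \<in> E. a \<cdot> f = f}"

lemma iso_idem_refl: "a \<in> E \<Longrightarrow> isomorphic_idempotents S mul a a"
  unfolding isomorphic_idempotents_def
  by (auto intro!: bexI[of _ a] simp: inv_idem idem_idem idem_in)

lemma iso_idem_sym: "isomorphic_idempotents S mul a b \<Longrightarrow> isomorphic_idempotents S mul b a"
  unfolding isomorphic_idempotents_def
  by (metis inv_closed inv_inv)

lemma iso_idem_trans:
  assumes "isomorphic_idempotents S mul a b" "isomorphic_idempotents S mul b c"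
  shows "isomorphic_idempotents S mul a c"
proof -
  obtain s t where st [simp]: "s \<in> S" "t \<in> S"
    and 1: "a = s\<^sup>\<star> \<cdot> s" "b = s \<cdot> s\<^sup>\<star>" "b = t\<^sup>\<star> \<cdot> t" "c = t \<cdot> t\<^sup>\<star>"
    and 2: "a \<in> E" "c \<in> E"
    using assms unfolding isomorphic_idempotents_def by blast
  have "(t \<cdot> s)\<^sup>\<star> \<cdot> (t \<cdot> s) = s\<^sup>\<star> \<cdot> (t\<^sup>\<star> \<cdot> t) \<cdot> s" by (simp add: inv_mul assoc)
  also have "\<dots> = a" unfolding 1(3)[symmetric] 1(1,2) by (simp add: assoc cancel)
  finally have 3: "a = (t \<cdot> s)\<^sup>\<star> \<cdot> (t \<cdot> s)" ..
  have "(t \<cdot> s) \<cdot> (t \<cdot> s)\<^sup>\<star> = t \<cdot> (s \<cdot> s\<^sup>\<star>) \<cdot> t\<^sup>\<star>" by (simp add: inv_mul assoc)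
  also have "\<dots> = c" unfolding 1(2)[symmetric] 1(3,4) by (simp add: assoc cancel)
  finally have 4: "c = (t \<cdot> s) \<cdot> (t \<cdot> s)\<^sup>\<star>" ..
  show ?thesis unfolding isomorphic_idempotents_def
    by (intro conjI bexI[of _ "t \<cdot> s"] 2 3 4 closed st)
qed

lemma iso_idem_ran: "x \<in> S \<Longrightarrow> isomorphic_idempotents S mul (x\<^sup>\<star> \<cdot> x) (x \<cdot> x\<^sup>\<star>)"
  unfolding isomorphic_idempotents_def by (auto simp: dom_idem ran_idem)

lemma green_equiv: "equiv S (green_D S mul)"
proof (rule equivI)
  show "green_D S mul \<subseteq> S \<times> S" by (auto simp: green_D_def)
  show "refl_on S (green_D S mul)"
    by (auto simp: refl_on_def green_D_def iso_idem_refl dom_idem)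
  show "sym (green_D S mul)" by (auto simp: sym_def green_D_def iso_idem_sym)
  show "trans (green_D S mul)" by (auto simp: trans_def green_D_def intro: iso_idem_trans)
qed

lemma green_idem_iff:
  "a \<in> E \<Longrightarrow> b \<in> E \<Longrightarrow> (a, b) \<in> green_D S mul \<longleftrightarrow> isomorphic_idempotents S mul a b"
  by (simp add: green_D_def inv_idem idem_idem idem_in)

section \<open>Ranks of idempotents in a finite inverse semigroup\<close>

context
  assumes fin: "finite S"
begin

lemma fin_idem: "finite E"
  using fin by (rule rev_finite_subset) (auto simp: idempotents_def)

lemma rank_mono:
  assumes a: "a \<in> E" and b: "b \<in> E" and ab: "b \<cdot> a = a"
  shows "rank a \<le> rank b"
  unfolding rank_def
proof (rule card_mono)
  show "finite {f \<in> E. b \<cdot> f = f}" using fin_idem by simp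
  have "b \<cdot> f = f" if f: "f \<in> E" "a \<cdot> f = f" for f
  proof -
    have "b \<cdot> f = (b \<cdot> a) \<cdot> f" using f a b by (simp add: idem_in assoc)
    thus ?thesis using f ab by simp
  qed
  thus "{f \<in> E. a \<cdot> f = f} \<subseteq> {f \<in> E. b \<cdot> f = f}" by auto
qed

text \<open>The idempotents below \<open>a\<close> are among those below \<open>b\<close>. If there
  are at least as many of them, the two finite sets agree, and then \<open>b\<close> itself lies
  below \<open>a\<close>.\<close>

lemma rank_strict:
  assumes a: "a \<in> E" and b: "b \<in> E" and ab: "b \<cdot> a = a" and r: "rank b \<le> rank a"
  shows "a = b"
proof -
  have "b \<cdot> f = f" if f: "f \<in> E" "a \<cdot> f = f" for f
  proof -
    have "b \<cdot> f = (b \<cdot> a) \<cdot> f" using f a b by (simp add: idem_in assoc)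
    thus ?thesis using f ab by simp
  qed
  hence "{f \<in> E. a \<cdot> f = f} \<subseteq> {f \<in> E. b \<cdot> f = f}" by auto
  moreover have "finite {f \<in> E. b \<cdot> f = f}" using fin_idem by simp
  ultimately have eq: "{f \<in> E. a \<cdot> f = f} = {f \<in> E. b \<cdot> f = f}"
    using card_seteq r unfolding rank_def by blast
  have "b \<in> {f \<in> E. a \<cdot> f = f}" unfolding eq using b by (simp add: idem_idem)
  hence "a \<cdot> b = b" by simp
  thus ?thesis using ab idem_commute[OF a b] by (metis (no_types))
qed

text \<open>Conjugation by \<open>x\<close> sends idempotents below the domain of \<open>x\<close>
  to idempotents below its range, and conjugation by the inverse of \<open>x\<close> undoes it.
  Applied to both \<open>x\<close> and its inverse this gives equality.\<close>

lemma rank_le_ran: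
  assumes x [simp]: "x \<in> S"
  shows "rank (x\<^sup>\<star> \<cdot> x) \<le> rank (x \<cdot> x\<^sup>\<star>)"
  unfolding rank_def
proof (rule card_inj_on_le)
  let ?c = "\<lambda>f. x \<cdot> f \<cdot> x\<^sup>\<star>"
  show "finite {f \<in> E. (x \<cdot> x\<^sup>\<star>) \<cdot> f = f}" using fin_idem by simp
  have "x\<^sup>\<star> \<cdot> ?c f \<cdot> x = f" if f: "f \<in> E" and xf: "(x\<^sup>\<star> \<cdot> x) \<cdot> f = f" for f
  proof -
    have [simp]: "f \<in> S" using f by (rule idem_in)
    have "x\<^sup>\<star> \<cdot> ?c f \<cdot> x = ((x\<^sup>\<star> \<cdot> x) \<cdot> f) \<cdot> (x\<^sup>\<star> \<cdot> x)" by (simp add: assoc)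
    also have "\<dots> = f" using xf idem_commute[OF f dom_idem[OF x]] by simp
    finally show ?thesis .
  qed
  thus "inj_on ?c {f \<in> E. (x\<^sup>\<star> \<cdot> x) \<cdot> f = f}"
    by (auto intro!: inj_on_inverseI[where g = "\<lambda>f. x\<^sup>\<star> \<cdot> f \<cdot> x"])
  have "?c f \<in> E \<and> (x \<cdot> x\<^sup>\<star>) \<cdot> ?c f = ?c f" if f: "f \<in> E" for f
    using conj_idem[OF x f] by (simp add: assoc cancel idem_in[OF f])
  thus "?c ` {f \<in> E. (x\<^sup>\<star> \<cdot> x) \<cdot> f = f} \<subseteq> {f \<in> E. (x \<cdot> x\<^sup>\<star>) \<cdot> f = f}"
    by blast
qed

lemma rank_ran: "x \<in> S \<Longrightarrow> rank (x \<cdot> x\<^sup>\<star>) = rank (x\<^sup>\<star> \<cdot> x)"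
  using rank_le_ran[of x] rank_le_ran[of "x\<^sup>\<star>"] by simp

end

end

section \<open>Coordinates of semigroup elements with respect to one D-class\<close>

locale d_class = inverse_semigroup +
  fixes e :: 'a and r :: nat and p :: "nat \<Rightarrow> 'a"
  assumes fin: "finite S"
    and e_idem: "e \<in> idempotents S mul"
    and p_in: "i < r \<Longrightarrow> p i \<in> S"
    and p_dom: "i < r \<Longrightarrow> mul (sinv S mul (p i)) (p i) = e"
    and p_inj: "i < r \<Longrightarrow> j < r \<Longrightarrow>
      mul (p i) (sinv S mul (p i)) = mul (p j) (sinv S mul (p j)) \<Longrightarrow> i = j"
    and p_cover: "x \<in> S \<Longrightarrow> mul (sinv S mul x) x = e \<Longrightarrow>
      \<exists>i<r. mul x (sinv S mul x) = mul (p i) (sinv S mul (p i))"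
begin

abbreviation "G \<equiv> maximal_subgroup S mul e"

text \<open>These elements form the L-class of \<open>e\<close>. The group \<open>G\<close> acts on
  it by right multiplication, the orbits are the sets of elements with a common range, and the
  \<open>p i\<close> represent the orbits.\<close>

definition based :: "'a \<Rightarrow> bool" where "based x \<longleftrightarrow> x \<in> S \<and> x\<^sup>\<star> \<cdot> x = e"

text \<open>If the value lies in \<open>G\<close>, it is the group element with
  \<open>t \<cdot> p j = p i \<cdot> coord i j t\<close>. For fixed \<open>j\<close> this happens
  for at most one \<open>i\<close>, so \<open>t\<close> acts as a matrix over \<open>G\<close> with
  at most one entry in each column. Values outside \<open>G\<close> stand for zero entries.\<close>

definition coord :: "nat \<Rightarrow> nat \<Rightarrow> 'a \<Rightarrow> 'a" where "coord i j t = (p i)\<^sup>\<star> \<cdot> (t \<cdot> p j)"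

declare p_in [simp]

lemma e_in [simp]: "e \<in> S" using e_idem by (rule idem_in)
lemma e_e [simp]: "e \<cdot> e = e" using e_idem by (rule idem_idem)
lemma inv_e [simp]: "e\<^sup>\<star> = e" using e_idem by (rule inv_idem)

lemma G_iff: "g \<in> G \<longleftrightarrow> g \<in> S \<and> g\<^sup>\<star> \<cdot> g = e \<and> g \<cdot> g\<^sup>\<star> = e"
  by (auto simp: maximal_subgroup_def)

lemma G_in: "g \<in> G \<Longrightarrow> g \<in> S" by (simp add: G_iff)

lemma finite_G: "finite G" using fin by (rule rev_finite_subset) (auto simp: G_in)

lemma based_p: "i < r \<Longrightarrow> based (p i)" by (simp add: based_def p_dom)
lemma based_G: "g \<in> G \<Longrightarrow> based g" by (simp add: based_def G_iff)
lemma based_in: "based x \<Longrightarrow> x \<in> S" by (simp add: based_def)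

lemma based_mul_e: "based x \<Longrightarrow> x \<cdot> e = x"
  unfolding based_def by (metis mul_inv_right)

lemma e_in_G [simp]: "e \<in> G" by (simp add: G_iff)

lemma G_mul_e [simp]: "g \<in> G \<Longrightarrow> g \<cdot> e = g" by (simp add: based_mul_e based_G)
lemma e_mul_G [simp]: "g \<in> G \<Longrightarrow> e \<cdot> g = g" unfolding G_iff by (metis mul_inv_mul)
lemma p_mul_e [simp]: "i < r \<Longrightarrow> p i \<cdot> e = p i" by (simp add: based_mul_e based_p)

lemma based_mul:
  assumes x: "based x" and g: "g \<in> G"
  shows "based (x \<cdot> g)" and "(x \<cdot> g) \<cdot> (x \<cdot> g)\<^sup>\<star> = x \<cdot> x\<^sup>\<star>"
proof -
  have [simp]: "x \<in> S" "g \<in> S" using x g by (auto simp: based_in G_in)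
  have "(x \<cdot> g)\<^sup>\<star> \<cdot> (x \<cdot> g) = g\<^sup>\<star> \<cdot> ((x\<^sup>\<star> \<cdot> x) \<cdot> g)" by (simp add: inv_mul assoc)
  also have "\<dots> = e" using x g by (simp add: based_def) (simp add: G_iff)
  finally show "based (x \<cdot> g)" by (simp add: based_def)
  have "(x \<cdot> g) \<cdot> (x \<cdot> g)\<^sup>\<star> = x \<cdot> (g \<cdot> g\<^sup>\<star>) \<cdot> x\<^sup>\<star>" by (simp add: inv_mul assoc)
  also have "g \<cdot> g\<^sup>\<star> = e" using g by (simp add: G_iff)
  finally show "(x \<cdot> g) \<cdot> (x \<cdot> g)\<^sup>\<star> = x \<cdot> x\<^sup>\<star>" using x by (simp add: based_mul_e)
qed

lemma G_closed [simp]: "g \<in> G \<Longrightarrow> h \<in> G \<Longrightarrow> g \<cdot> h \<in> G"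
  by (metis G_iff based_G based_def based_mul)

lemma G_inv [simp]: "g \<in> G \<Longrightarrow> g\<^sup>\<star> \<in> G" by (simp add: G_iff)

text \<open>Left multiplication can only shrink a domain: \<open>e\<close> is the domain of
  \<open>t \<cdot> y\<close>, hence below that of \<open>y\<close>, which in turn is below
  \<open>e\<close>.\<close>

lemma based_right:
  assumes [simp]: "t \<in> S" "y \<in> S" and ye: "y \<cdot> e = y" and ty: "based (t \<cdot> y)"
  shows "based y"
proof -
  have d: "y\<^sup>\<star> \<cdot> (t\<^sup>\<star> \<cdot> (t \<cdot> y)) = e" using ty by (simp add: based_def inv_mul assoc)
  have "y\<^sup>\<star> \<cdot> y = y\<^sup>\<star> \<cdot> y \<cdot> e" by (simp add: assoc ye)
  also have "\<dots> = y\<^sup>\<star> \<cdot> y \<cdot> (y\<^sup>\<star> \<cdot> (t\<^sup>\<star> \<cdot> (t \<cdot> y)))" by (simp only: d)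
  also have "\<dots> = y\<^sup>\<star> \<cdot> (t\<^sup>\<star> \<cdot> (t \<cdot> y))" by (simp add: assoc cancel)
  also have "\<dots> = e" by (rule d)
  finally show ?thesis by (simp add: based_def)
qed

lemma coset_split:
  assumes q: "based q" and [simp]: "x \<in> S" and xe: "x \<cdot> e = x" and g: "q\<^sup>\<star> \<cdot> x \<in> G"
  shows "x = q \<cdot> (q\<^sup>\<star> \<cdot> x)"
proof -
  have [simp]: "q \<in> S" using q by (rule based_in)
  have "based (q \<cdot> (q\<^sup>\<star> \<cdot> x))" by (rule based_mul(1)[OF q g])
  hence "(q \<cdot> q\<^sup>\<star> \<cdot> x)\<^sup>\<star> \<cdot> (q \<cdot> q\<^sup>\<star> \<cdot> x) = e" by (simp add: based_def assoc)
  from idem_mul_eq[OF _ ran_idem this xe] show ?thesis by (simp add: assoc)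
qed

text \<open>The left side tests whether \<open>x\<close> lies in the orbit of \<open>q\<close> under
  \<open>G\<close>: in that case \<open>x\<close> is recovered by \<open>coset_split\<close>. The
  orbit consists of the based elements that have the range of \<open>q\<close>.\<close>

lemma coset_iff:
  assumes q: "based q" and [simp]: "x \<in> S" and xe: "x \<cdot> e = x"
  shows "q\<^sup>\<star> \<cdot> x \<in> G \<longleftrightarrow> based x \<and> x \<cdot> x\<^sup>\<star> = q \<cdot> q\<^sup>\<star>"
proof
  assume g: "q\<^sup>\<star> \<cdot> x \<in> G"
  show "based x \<and> x \<cdot> x\<^sup>\<star> = q \<cdot> q\<^sup>\<star>"
    using based_mul[OF q g] coset_split[OF q _ xe g] by simp
next
  have [simp]: "q \<in> S" using q by (rule based_in)
  assume x: "based x \<and> x \<cdot> x\<^sup>\<star> = q \<cdot> q\<^sup>\<star>"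
  have "(q\<^sup>\<star> \<cdot> x)\<^sup>\<star> \<cdot> (q\<^sup>\<star> \<cdot> x) = x\<^sup>\<star> \<cdot> ((q \<cdot> q\<^sup>\<star>) \<cdot> x)" by (simp add: inv_mul assoc)
  also have "\<dots> = x\<^sup>\<star> \<cdot> ((x \<cdot> x\<^sup>\<star>) \<cdot> x)" by (simp only: conjunct2[OF x])
  also have "\<dots> = e" using conjunct1[OF x] by (simp add: mul_inv_mul based_def)
  finally have 1: "(q\<^sup>\<star> \<cdot> x)\<^sup>\<star> \<cdot> (q\<^sup>\<star> \<cdot> x) = e" .
  have "(q\<^sup>\<star> \<cdot> x) \<cdot> (q\<^sup>\<star> \<cdot> x)\<^sup>\<star> = q\<^sup>\<star> \<cdot> (x \<cdot> x\<^sup>\<star>) \<cdot> q" by (simp add: inv_mul assoc)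
  also have "\<dots> = q\<^sup>\<star> \<cdot> (q \<cdot> q\<^sup>\<star>) \<cdot> q" by (simp only: conjunct2[OF x])
  also have "\<dots> = e" using q by (simp add: assoc cancel based_def)
  finally show "q\<^sup>\<star> \<cdot> x \<in> G" using 1 by (simp add: G_iff)
qed

lemma mul_p_e: "t \<in> S \<Longrightarrow> j < r \<Longrightarrow> (t \<cdot> p j) \<cdot> e = t \<cdot> p j"
  by (simp add: assoc)

lemma coord_in: "i < r \<Longrightarrow> j < r \<Longrightarrow> t \<in> S \<Longrightarrow> coord i j t \<in> S"
  by (simp add: coord_def)

lemma coord_iff:
  assumes "i < r" "j < r" "t \<in> S"
  shows "coord i j t \<in> G \<longleftrightarrow>
    based (t \<cdot> p j) \<and> (t \<cdot> p j) \<cdot> (t \<cdot> p j)\<^sup>\<star> = p i \<cdot> (p i)\<^sup>\<star>"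
  unfolding coord_def using assms by (intro coset_iff) (auto simp: based_p mul_p_e)

lemma mul_p_eq:
  assumes "i < r" "j < r" "t \<in> S" "coord i j t \<in> G"
  shows "t \<cdot> p j = p i \<cdot> coord i j t"
  using assms unfolding coord_def by (intro coset_split) (auto simp: based_p mul_p_e)

lemma coord_unique:
  assumes "i < r" "i' < r" "j < r" "t \<in> S" "coord i j t \<in> G" "coord i' j t \<in> G"
  shows "i = i'"
  using assms by (intro p_inj) (auto simp: coord_iff)

lemma based_coord:
  assumes "j < r" "t \<in> S" "based (t \<cdot> p j)"
  shows "\<exists>i<r. coord i j t \<in> G"
proof -
  obtain i where "i < r" "(t \<cdot> p j) \<cdot> (t \<cdot> p j)\<^sup>\<star> = p i \<cdot> (p i)\<^sup>\<star>"
    using p_cover[of "t \<cdot> p j"] assms by (auto simp: based_def)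
  thus ?thesis using assms by (auto simp: coord_iff)
qed

text \<open>Column \<open>k\<close> of \<open>u\<close> has its only group entry in row
  \<open>j\<close>, so the matrix product reduces to one term. The next two lemmas settle whether
  this term lies in \<open>G\<close>, and the case of a column without entries.\<close>

lemma coord_mul:
  assumes "i < r" "j < r" "k < r" and [simp]: "t \<in> S" "u \<in> S" and g: "coord j k u \<in> G"
  shows "coord i k (t \<cdot> u) = coord i j t \<cdot> coord j k u"
proof -
  have "coord i k (t \<cdot> u) = (p i)\<^sup>\<star> \<cdot> (t \<cdot> (u \<cdot> p k))" using assms by (simp add: coord_def assoc)
  also have "u \<cdot> p k = p j \<cdot> coord j k u" using assms by (intro mul_p_eq) auto
  finally show ?thesis using assms(1-3) by (simp add: coord_def[of i j] assoc G_in[OF g])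
qed

lemma coord_mul_iff:
  assumes "i < r" "j < r" "k < r" and [simp]: "t \<in> S" "u \<in> S" and g: "coord j k u \<in> G"
  shows "coord i k (t \<cdot> u) \<in> G \<longleftrightarrow> coord i j t \<in> G"
proof
  let ?g = "coord j k u" and ?h = "coord i j t"
  have [simp]: "?h \<in> S" using assms by (simp add: coord_in)
  have "?h \<cdot> e = ?h" using assms by (simp add: coord_def assoc)
  hence "?h = (?h \<cdot> ?g) \<cdot> ?g\<^sup>\<star>" using conjunct2[OF conjunct2[OF g[unfolded G_iff]]] by (simp add: assoc G_in[OF g])
  moreover assume "coord i k (t \<cdot> u) \<in> G"
  hence "?h \<cdot> ?g \<in> G" using assms by (simp add: coord_mul)
  ultimately show "?h \<in> G" using g G_closed[of "?h \<cdot> ?g" "?g\<^sup>\<star>"] by simp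
qed (use assms g in \<open>simp add: coord_mul\<close>)

lemma coord_mul_none:
  assumes "i < r" "k < r" and [simp]: "t \<in> S" "u \<in> S" and none: "\<And>j. j < r \<Longrightarrow> coord j k u \<notin> G"
  shows "coord i k (t \<cdot> u) \<notin> G"
proof
  assume "coord i k (t \<cdot> u) \<in> G"
  hence b: "based (t \<cdot> (u \<cdot> p k))" using assms(1,2) by (simp add: coord_iff assoc)
  have "based (u \<cdot> p k)"
    by (rule based_right[OF _ _ mul_p_e b]) (simp_all add: assms(1,2))
  thus False using based_coord assms by blast
qed

lemma rank_based: "based x \<Longrightarrow> rank (x \<cdot> x\<^sup>\<star>) = rank e"
  using rank_ran[OF fin, of x] by (simp add: based_def)

text \<open>The range of \<open>x\<close> is isomorphic to \<open>e\<close> and lies below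
  \<open>e\<close>; in a finite semigroup it cannot lie strictly below, so it equals
  \<open>e\<close>.\<close>

lemma based_below_G:
  assumes x: "based x" and ex: "e \<cdot> x = x"
  shows "x \<in> G"
proof -
  have [simp]: "x \<in> S" using x by (rule based_in)
  have "e \<cdot> (x \<cdot> x\<^sup>\<star>) = x \<cdot> x\<^sup>\<star>" using ex by (simp flip: assoc)
  from rank_strict[OF fin ran_idem e_idem this] have "x \<cdot> x\<^sup>\<star> = e"
    by (simp add: rank_based[OF x])
  thus ?thesis using x by (simp add: G_iff based_def)
qed

lemma rank_not_based:
  assumes [simp]: "x \<in> S" and xe: "x \<cdot> e = x" and n: "\<not> based x"
  shows "rank (x\<^sup>\<star> \<cdot> x) < rank e"
proof -
  have d: "x\<^sup>\<star> \<cdot> x \<in> E" by (simp add: dom_idem)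
  have "e \<cdot> (x\<^sup>\<star> \<cdot> x) = (x\<^sup>\<star> \<cdot> x) \<cdot> e" by (rule idem_commute[OF e_idem d])
  also have "\<dots> = x\<^sup>\<star> \<cdot> x" using xe by (simp add: assoc)
  finally show ?thesis using rank_strict[OF fin d e_idem] n by (force simp: based_def)
qed

text \<open>An element of the corner at \<open>e\<close> is either in \<open>G\<close> or has a
  domain of smaller rank. A representation that vanishes on idempotents of smaller rank therefore
  sees only \<open>G\<close> in this corner.\<close>

lemma rank_corner:
  assumes [simp]: "s \<in> S" and n: "e \<cdot> (s \<cdot> e) \<notin> G"
  shows "rank ((e \<cdot> (s \<cdot> e))\<^sup>\<star> \<cdot> (e \<cdot> (s \<cdot> e))) < rank e"
proof (rule rank_not_based)
  have "e \<cdot> (e \<cdot> (s \<cdot> e)) = e \<cdot> (s \<cdot> e)" by (simp flip: assoc)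
  thus "\<not> based (e \<cdot> (s \<cdot> e))" using based_below_G n by blast
qed (auto simp: assoc)

lemma coord_unit_in:
  assumes [simp]: "a < r" "b < r" and g: "g \<in> G"
  shows "p a \<cdot> g \<cdot> (p b)\<^sup>\<star> \<in> S" "coord a b (p a \<cdot> g \<cdot> (p b)\<^sup>\<star>) = g"
proof -
  have [simp]: "g \<in> S" using g by (rule G_in)
  show "p a \<cdot> g \<cdot> (p b)\<^sup>\<star> \<in> S" by simp
  have "coord a b (p a \<cdot> g \<cdot> (p b)\<^sup>\<star>) = ((p a)\<^sup>\<star> \<cdot> p a) \<cdot> (g \<cdot> ((p b)\<^sup>\<star> \<cdot> p b))"
    by (simp add: coord_def assoc)
  also have "\<dots> = g" using g by (simp add: p_dom)
  finally show "coord a b (p a \<cdot> g \<cdot> (p b)\<^sup>\<star>) = g" .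
qed

text \<open>These elements play the role of matrix units. An entry in column \<open>j\<close> makes
  \<open>(p b)\<^sup>\<star> \<cdot> p j\<close> a based element fixed by \<open>e\<close> on the
  left, hence a member of \<open>G\<close>. Then \<open>p b\<close> and \<open>p j\<close> have the
  same range, so the columns agree.\<close>

lemma coord_unit_iff:
  assumes [simp]: "a < r" "b < r" "i < r" "j < r" and g: "g \<in> G"
  shows "coord i j (p a \<cdot> g \<cdot> (p b)\<^sup>\<star>) \<in> G \<longleftrightarrow> i = a \<and> j = b"
proof
  have [simp]: "g \<in> S" using g by (rule G_in)
  let ?y = "(p b)\<^sup>\<star> \<cdot> p j"
  have eq: "(p a \<cdot> g \<cdot> (p b)\<^sup>\<star>) \<cdot> p j = (p a \<cdot> g) \<cdot> ?y" by (simp add: assoc)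
  assume c: "coord i j (p a \<cdot> g \<cdot> (p b)\<^sup>\<star>) \<in> G"
  hence b: "based ((p a \<cdot> g) \<cdot> ?y)" by (simp add: coord_iff eq)
  have "based ?y" by (rule based_right[OF _ _ _ b]) (simp_all add: assoc)
  moreover have "e \<cdot> ?y = ?y"
    using p_dom[of b, symmetric] by (simp add: assoc cancel)
  ultimately have "?y \<in> G" by (rule based_below_G)
  hence "p j \<cdot> (p j)\<^sup>\<star> = p b \<cdot> (p b)\<^sup>\<star>" by (subst (asm) coset_iff) (auto simp: based_p)
  hence [simp]: "j = b" by (intro p_inj) auto
  have "i = a"
    using c coord_unit_in[OF assms(1,2) g] g
    by (intro coord_unique[of i a b "p a \<cdot> g \<cdot> (p b)\<^sup>\<star>"]) auto
  thus "i = a \<and> j = b" by simp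
qed (use coord_unit_in[OF assms(1,2) g] g in simp)

text \<open>For an element \<open>f \<cdot> t\<close> below \<open>t\<close>, multiplying by
  \<open>p j\<close> gives \<open>p i \<cdot> h\<close>, whose domain is already \<open>e\<close>,
  so \<open>f\<close> leaves \<open>t \<cdot> p j\<close> unchanged. Conversely, the element in
  question is \<open>t\<close> restricted to the range of \<open>p j\<close>, and
  \<open>swap_right\<close> rewrites the restriction as a left multiplication.\<close>

lemma coord_eq_iff_natural_le:
  assumes [simp]: "i < r" "j < r" "t \<in> S" and h: "h \<in> G"
  shows "natural_le S mul (p i \<cdot> h \<cdot> (p j)\<^sup>\<star>) t \<longleftrightarrow> coord i j t = h"
proof
  have [simp]: "h \<in> S" using h by (rule G_in)
  assume "natural_le S mul (p i \<cdot> h \<cdot> (p j)\<^sup>\<star>) t"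
  then obtain f where f: "f \<in> E" and eq: "p i \<cdot> h \<cdot> (p j)\<^sup>\<star> = f \<cdot> t"
    by (auto simp: natural_le_def)
  have [simp]: "f \<in> S" using f by (rule idem_in)
  have "p i \<cdot> h = p i \<cdot> (h \<cdot> ((p j)\<^sup>\<star> \<cdot> p j))" using h by (simp add: p_dom)
  also have "\<dots> = (p i \<cdot> h \<cdot> (p j)\<^sup>\<star>) \<cdot> p j" by (simp add: assoc)
  also have "\<dots> = f \<cdot> (t \<cdot> p j)" by (simp add: eq assoc)
  finally have ft: "f \<cdot> (t \<cdot> p j) = p i \<cdot> h" ..
  have "based (p i \<cdot> h)" by (intro based_mul based_p h) simp
  hence "f \<cdot> (t \<cdot> p j) = t \<cdot> p j"
    by (intro idem_mul_eq[where e = e] f) (auto simp: ft based_def assoc)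
  hence "coord i j t = (p i)\<^sup>\<star> \<cdot> (p i \<cdot> h)" using ft by (simp add: coord_def)
  also have "\<dots> = ((p i)\<^sup>\<star> \<cdot> p i) \<cdot> h" by (simp add: assoc)
  also have "\<dots> = h" using h by (simp add: p_dom)
  finally show "coord i j t = h" .
next
  have [simp]: "h \<in> S" using h by (rule G_in)
  assume c: "coord i j t = h"
  hence "p i \<cdot> h = t \<cdot> p j" using mul_p_eq[of i j t] h by simp
  hence "p i \<cdot> h \<cdot> (p j)\<^sup>\<star> = t \<cdot> (p j \<cdot> (p j)\<^sup>\<star>)" by (simp add: assoc)
  also have "\<dots> = (t \<cdot> (p j \<cdot> (p j)\<^sup>\<star>) \<cdot> t\<^sup>\<star>) \<cdot> t" by (intro swap_right ran_idem) simp_all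
  finally show "natural_le S mul (p i \<cdot> h \<cdot> (p j)\<^sup>\<star>) t"
    unfolding natural_le_def by (blast intro: conj_idem ran_idem assms p_in)
qed

text \<open>The range of \<open>f \<cdot> p j\<close> is an idempotent isomorphic to
  \<open>e\<close> and below \<open>f\<close>. This compares the ranks of \<open>e\<close> and
  \<open>f\<close>, and equal ranks make that range equal to \<open>f\<close>. It is the means to
  tell different D-classes apart.\<close>

lemma coord_idem:
  assumes [simp]: "i < r" "j < r" and f: "f \<in> E" and c: "coord i j f \<in> G"
  shows "rank e \<le> rank f" and "rank f \<le> rank e \<Longrightarrow> isomorphic_idempotents S mul e f"
proof -
  have [simp]: "f \<in> S" using f by (rule idem_in)
  define x where "x = f \<cdot> p j"
  have x: "based x" using c by (simp add: coord_iff x_def)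
  have [simp]: "x \<in> S" using x by (rule based_in)
  have fx: "f \<cdot> (x \<cdot> x\<^sup>\<star>) = x \<cdot> x\<^sup>\<star>" by (simp add: x_def idem_left f assoc)
  have E: "x \<cdot> x\<^sup>\<star> \<in> E" using x by (simp add: ran_idem)
  show "rank e \<le> rank f" using rank_mono[OF fin E f fx] rank_based[OF x] by simp
  assume "rank f \<le> rank e"
  hence "x \<cdot> x\<^sup>\<star> = f" using rank_strict[OF fin E f fx] rank_based[OF x] by simp
  thus "isomorphic_idempotents S mul e f" using iso_idem_ran[of x] x by (simp add: based_def)
qed

end

section \<open>Representations and Schur's lemma\<close>

lemma left_inverse_dim_le:
  fixes X Y :: "complex mat"
  assumes X: "X \<in> carrier_mat d n" and Y: "Y \<in> carrier_mat n d" and XY: "X * Y = 1\<^sub>m d"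
  shows "d \<le> n"
proof (rule ccontr)
  assume "\<not> d \<le> n"
  hence nd: "n < d" by simp
  \<comment> \<open>Padding with zeros to size \<open>d\<close> keeps the product equal to the
    identity. For square matrices the reversed product is then the identity too, but row
    \<open>n\<close> of \<open>Y'\<close> is zero.\<close>
  define X' where "X' = mat d d (\<lambda>(i, j). if j < n then X $$ (i, j) else 0)"
  define Y' where "Y' = mat d d (\<lambda>(i, j). if i < n then Y $$ (i, j) else 0)"
  have "X' * Y' = 1\<^sub>m d"
  proof (rule eq_matI)
    fix i j assume "i < dim_row (1\<^sub>m d)" "j < dim_col (1\<^sub>m d)"
    hence ij: "i < d" "j < d" by simp_all
    have "(X' * Y') $$ (i, j) = (\<Sum>k\<in>{0..<d}. if k < n then X $$ (i, k) * Y $$ (k, j) else 0)"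
      using ij by (auto simp: X'_def Y'_def scalar_prod_def intro!: sum.cong)
    also have "\<dots> = (\<Sum>k\<in>{0..<n}. X $$ (i, k) * Y $$ (k, j))"
      using nd by (intro sum.mono_neutral_cong_right) auto
    also have "\<dots> = (X * Y) $$ (i, j)" using ij X Y by (auto simp: scalar_prod_def)
    finally show "(X' * Y') $$ (i, j) = 1\<^sub>m d $$ (i, j)" unfolding XY .
  qed (auto simp: X'_def Y'_def)
  hence "Y' * X' = 1\<^sub>m d"
    by (rule mat_mult_left_right_inverse[rotated 2]) (auto simp: X'_def Y'_def)
  moreover have "(Y' * X') $$ (n, n) = 0" using nd by (auto simp: X'_def Y'_def scalar_prod_def)
  ultimately show False using nd by simp
qed

text \<open>The columns of \<open>B\<close> are a basis of the image of \<open>E\<close>, found as a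
  family of the largest possible size that is fixed by \<open>E\<close> and has a left inverse;
  \<open>left_inverse_dim_le\<close> bounds the size. The second factor returned is
  \<open>C * E\<close>, because a left inverse \<open>C\<close> need not vanish on the kernel of
  \<open>E\<close>.\<close>

lemma idempotent_factorization:
  fixes E :: "complex mat"
  assumes E: "E \<in> carrier_mat n n" and EE: "E * E = E"
  obtains d B C where "B \<in> carrier_mat n d" "C \<in> carrier_mat d n" "B * C = E" "C * B = 1\<^sub>m d"
proof -
  define Q where "Q d \<longleftrightarrow> (\<exists>B C. B \<in> carrier_mat n d \<and> C \<in> carrier_mat d n \<and> C * B = 1\<^sub>m d \<and> E * B = B)"
    for d
  have "Q 0" unfolding Q_def
    by (intro exI[of _ "0\<^sub>m n 0"] exI[of _ "0\<^sub>m 0 n"]) (use E in auto)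
  moreover have bound: "\<forall>d. Q d \<longrightarrow> d \<le> n" unfolding Q_def using left_inverse_dim_le by blast
  ultimately have "\<exists>d. Q d \<and> (\<forall>d'. Q d' \<longrightarrow> d' \<le> d)"
    by (metis GreatestI_nat Greatest_le_nat)
  then obtain d where d: "Q d" and max: "\<And>d'. Q d' \<Longrightarrow> d' \<le> d" by auto
  then obtain B C where B: "B \<in> carrier_mat n d" and C: "C \<in> carrier_mat d n"
    and CB: "C * B = 1\<^sub>m d" and EB: "E * B = B" unfolding Q_def by blast
  \<comment> \<open>A nonzero entry of \<open>X\<close> would allow enlarging \<open>B\<close> by a column of \<open>X\<close> and \<open>C\<close> by a scaled row of \<open>Y\<close>.\<close>
  define X where "X = E - B * (C * E)"
  define Y where "Y = 1\<^sub>m n - B * C"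
  have XY: "X \<in> carrier_mat n n" "Y \<in> carrier_mat n n"
    using E B C by (auto simp: X_def Y_def)
  have EX: "E * X = X" unfolding X_def using E B C
    by (simp add: mult_minus_distrib_mat[of _ n n _ n] EE assoc_mult_mat[of E n n B d "C * E" n, symmetric] EB)
  have "C * (B * (C * E)) = C * E"
    using E B C by (simp add: assoc_mult_mat[of C d n B d "C * E" n, symmetric] CB del: assoc_mult_mat)
  hence CX: "C * X = 0\<^sub>m d n" unfolding X_def using E B C
    by (simp add: mult_minus_distrib_mat[of _ d n _ n])
  have YB: "Y * B = 0\<^sub>m n d" unfolding Y_def using B C
    by (simp add: minus_mult_distrib_mat[of _ n n] assoc_mult_mat[of B n d C n] CB)
  have [simp]: "X - 0\<^sub>m n n = X" using XY by (intro eq_matI) auto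
  have YX: "Y * X = X" unfolding Y_def using B C XY
    by (simp add: minus_mult_distrib_mat[of _ n n] assoc_mult_mat[of B n d C n] CX)
  have "X = 0\<^sub>m n n"
  proof (rule ccontr)
    assume "X \<noteq> 0\<^sub>m n n"
    then obtain k l where kl: "k < n" "l < n" "X $$ (k, l) \<noteq> 0"
      using XY by (metis carrier_matD eq_matI index_zero_mat)
    define B' where "B' = mat n (Suc d) (\<lambda>(i, j). if j < d then B $$ (i, j) else X $$ (i, l))"
    define C' where "C' = mat (Suc d) n
      (\<lambda>(i, j). if i < d then C $$ (i, j) else Y $$ (k, j) / X $$ (k, l))"
    have 1: "(\<Sum>x\<in>{0..<n}. C $$ (i, x) * B $$ (x, j)) = (if i = j then 1 else 0)"
      if "i < d" "j < d" for i j
      using arg_cong[OF CB, of "\<lambda>M. M $$ (i, j)"] that B C by (simp add: scalar_prod_def)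
    have 2: "(\<Sum>x\<in>{0..<n}. C $$ (i, x) * X $$ (x, l)) = 0" if "i < d" for i
      using arg_cong[OF CX, of "\<lambda>M. M $$ (i, l)"] that kl C XY by (simp add: scalar_prod_def)
    have 3: "(\<Sum>x\<in>{0..<n}. Y $$ (k, x) * B $$ (x, j)) = 0" if "j < d" for j
      using arg_cong[OF YB, of "\<lambda>M. M $$ (k, j)"] that kl B XY by (simp add: scalar_prod_def)
    have 4: "(\<Sum>x\<in>{0..<n}. Y $$ (k, x) * X $$ (x, l)) = X $$ (k, l)"
      using arg_cong[OF YX, of "\<lambda>M. M $$ (k, l)"] kl XY by (simp add: scalar_prod_def)
    have 5: "(\<Sum>x\<in>{0..<n}. E $$ (i, x) * B $$ (x, j)) = B $$ (i, j)" if "i < n" "j < d" for i j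
      using arg_cong[OF EB, of "\<lambda>M. M $$ (i, j)"] that E B by (simp add: scalar_prod_def)
    have 6: "(\<Sum>x\<in>{0..<n}. E $$ (i, x) * X $$ (x, l)) = X $$ (i, l)" if "i < n" for i
      using arg_cong[OF EX, of "\<lambda>M. M $$ (i, l)"] that kl E XY by (simp add: scalar_prod_def)
    have "C' * B' = 1\<^sub>m (Suc d)"
    proof (rule eq_matI)
      fix i j assume ij: "i < dim_row (1\<^sub>m (Suc d))" "j < dim_col (1\<^sub>m (Suc d))"
      hence "(C' * B') $$ (i, j) = (\<Sum>x\<in>{0..<n}.
          (if i < d then C $$ (i, x) else Y $$ (k, x) / X $$ (k, l)) *
          (if j < d then B $$ (x, j) else X $$ (x, l)))"
        by (simp add: B'_def C'_def scalar_prod_def)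
      also have "\<dots> = (if i = j then 1 else 0)"
        using ij kl 1 2 3 4 by (auto simp: less_Suc_eq simp flip: sum_divide_distrib)
      finally show "(C' * B') $$ (i, j) = 1\<^sub>m (Suc d) $$ (i, j)" using ij by simp
    qed (auto simp: B'_def C'_def)
    moreover have "E * B' = B'"
    proof (rule eq_matI)
      fix i j assume ij: "i < dim_row B'" "j < dim_col B'"
      hence "(E * B') $$ (i, j) = (\<Sum>x\<in>{0..<n}. E $$ (i, x) *
          (if j < d then B $$ (x, j) else X $$ (x, l)))"
        using E by (simp add: B'_def scalar_prod_def)
      also have "\<dots> = (if j < d then B $$ (i, j) else X $$ (i, l))"
        using ij 5 6 by (simp add: B'_def)
      finally show "(E * B') $$ (i, j) = B' $$ (i, j)" using ij by (simp add: B'_def)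
    qed (use E in \<open>auto simp: B'_def\<close>)
    ultimately have "Q (Suc d)" unfolding Q_def
      by (intro exI[of _ B'] exI[of _ C']) (auto simp: B'_def C'_def)
    thus False using max by fastforce
  qed
  hence X0: "E - B * (C * E) = 0\<^sub>m n n" by (simp add: X_def)
  have "E $$ (i, j) = (B * (C * E)) $$ (i, j)" if "i < n" "j < n" for i j
    using arg_cong[OF X0, of "\<lambda>M. M $$ (i, j)"] that E B C by simp
  hence "E = B * (C * E)" using E B C by (intro eq_matI) auto
  moreover have "(C * E) * B = 1\<^sub>m d"
    using E B C CB by (simp add: EB)
  ultimately show ?thesis using that[of B d "C * E"] B C E by simp
qed

section \<open>Subspaces, linear extension and irreducibility on basis elements\<close>

abbreviation subspace_vec :: "nat \<Rightarrow> complex vec set \<Rightarrow> bool" where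
  "subspace_vec d W \<equiv> submodule class_ring W (module_vec TYPE(complex) d)"

lemma subspace_vec_iff:
  "subspace_vec d W \<longleftrightarrow> W \<subseteq> carrier_vec d \<and> 0\<^sub>v d \<in> W \<and>
     (\<forall>v\<in>W. \<forall>w\<in>W. v + w \<in> W) \<and> (\<forall>c. \<forall>v\<in>W. c \<cdot>\<^sub>v v \<in> W)"
  unfolding submodule_def using vec_module by (auto simp: module_vec_simps)

lemma subspace_vec_UNIV:
  assumes W: "subspace_vec d W" and u: "\<And>i. i < d \<Longrightarrow> unit_vec d i \<in> W"
  shows "W = carrier_vec d"
proof
  show "W \<subseteq> carrier_vec d" using W by (simp add: subspace_vec_iff)
  show "carrier_vec d \<subseteq> W"
  proof
    fix v :: "complex vec" assume v: "v \<in> carrier_vec d"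
    have "vec d (\<lambda>i. if i < m then v $ i else 0) \<in> W" if "m \<le> d" for m
      using that
    proof (induction m)
      case 0
      have "vec d (\<lambda>i. if i < 0 then v $ i else 0) = 0\<^sub>v d" by auto
      thus ?case using W by (simp add: subspace_vec_iff)
    next
      case (Suc m)
      have "vec d (\<lambda>i. if i < Suc m then v $ i else 0)
          = vec d (\<lambda>i. if i < m then v $ i else 0) + v $ m \<cdot>\<^sub>v unit_vec d m"
        using Suc.prems by (intro eq_vecI) (auto simp: less_Suc_eq unit_vec_def)
      thus ?case using Suc u[of m] W by (simp add: subspace_vec_iff)
    qed
    from this[of d] have "vec d (\<lambda>i. if i < d then v $ i else 0) \<in> W" by simp
    moreover have "vec d (\<lambda>i. if i < d then v $ i else 0) = v" using v by auto
    ultimately show "v \<in> W" by simp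
  qed
qed

lemma semigroup_algebra_point_mass [simp]: "s \<in> S \<Longrightarrow> point_mass s \<in> semigroup_algebra S"
  by (auto simp: semigroup_algebra_def point_mass_def)

text \<open>Builds \<open>f\<close> by enlarging the set of points at which its values are kept.
  This carries statements about representing matrices from point masses to the whole
  algebra.\<close>

lemma semigroup_algebra_induct [consumes 2, case_names zero step]:
  assumes fin: "finite S" and f: "f \<in> semigroup_algebra S"
    and zero: "P (\<lambda>_. 0)"
    and step: "\<And>s c f. s \<in> S \<Longrightarrow> f \<in> semigroup_algebra S \<Longrightarrow> P f \<Longrightarrow>
      P (\<lambda>t. c * point_mass s t + f t)"
  shows "P f"
proof -
  have "P (\<lambda>t. if t \<in> T then f t else 0)" if "T \<subseteq> S" for T
    using rev_finite_subset[OF fin that] that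
  proof (induction T rule: finite_induct)
    case empty
    thus ?case using zero by simp
  next
    case (insert s T)
    have "(\<lambda>t. if t \<in> insert s T then f t else 0)
        = (\<lambda>t. f s * point_mass s t + (if t \<in> T then f t else 0))"
      using insert.hyps by (auto simp: point_mass_def)
    thus ?case using insert by (auto intro!: step simp: semigroup_algebra_def)
  qed
  from this[of S] have "P (\<lambda>t. if t \<in> S then f t else 0)" by simp
  moreover have "(\<lambda>t. if t \<in> S then f t else 0) = f" using f by (auto simp: semigroup_algebra_def)
  ultimately show ?thesis by simp
qed

lemma mult_mat_zero_vec: "(A :: complex mat) \<in> carrier_mat m n \<Longrightarrow> A *\<^sub>v 0\<^sub>v n = 0\<^sub>v m"
  by (intro eq_vecI) auto

lemma zero_mult_mat_vec: "v \<in> carrier_vec n \<Longrightarrow> 0\<^sub>m m n *\<^sub>v v = (0\<^sub>v m :: complex vec)"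
  by (intro eq_vecI) auto

lemma smult_mult_mat_vec:
  "A \<in> carrier_mat m n \<Longrightarrow> v \<in> carrier_vec n \<Longrightarrow>
    (c \<cdot>\<^sub>m A) *\<^sub>v v = (c :: complex) \<cdot>\<^sub>v (A *\<^sub>v v)"
  by (intro eq_vecI) (auto simp: scalar_prod_def sum_distrib_left mult_ac)

definition linear_extension ::
    "'a set \<Rightarrow> nat \<Rightarrow> ('a \<Rightarrow> complex mat) \<Rightarrow> ('a \<Rightarrow> complex) \<Rightarrow> complex mat" where
  "linear_extension S d M f = mat d d (\<lambda>(i, j). \<Sum>s\<in>S. f s * M s $$ (i, j))"

lemma linear_extension_point_mass:
  assumes "finite S" "s \<in> S" "M s \<in> carrier_mat d d"
  shows "linear_extension S d M (point_mass s) = M s"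
proof (rule eq_matI)
  fix i j assume ij: "i < dim_row (M s)" "j < dim_col (M s)"
  have "(\<Sum>t\<in>S. point_mass s t * M t $$ (i, j)) = (\<Sum>t\<in>S. if t = s then M t $$ (i, j) else 0)"
    by (intro sum.cong) (auto simp: point_mass_def)
  also have "\<dots> = M s $$ (i, j)" using assms by simp
  finally show "linear_extension S d M (point_mass s) $$ (i, j) = M s $$ (i, j)"
    using ij assms by (simp add: linear_extension_def)
qed (use assms in \<open>auto simp: linear_extension_def\<close>)

lemma representation_linear_extension:
  assumes fin: "finite S" and cl: "\<And>s t. s \<in> S \<Longrightarrow> t \<in> S \<Longrightarrow> mul s t \<in> S"
    and M: "\<And>s. s \<in> S \<Longrightarrow> M s \<in> carrier_mat d d"
    and mult: "\<And>s t. s \<in> S \<Longrightarrow> t \<in> S \<Longrightarrow> M (mul s t) = M s * M t"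
  shows "representation S mul d (linear_extension S d M)"
  unfolding representation_def
proof (intro conjI ballI allI)
  fix f g
  let ?L = "linear_extension S d M"
  show "?L (convolution S mul f g) = ?L f * ?L g"
  proof (rule eq_matI)
    fix i j assume "i < dim_row (?L f * ?L g)" "j < dim_col (?L f * ?L g)"
    hence ij: "i < d" "j < d" by (auto simp: linear_extension_def)
    have "?L (convolution S mul f g) $$ (i, j)
        = (\<Sum>s\<in>S. \<Sum>(t, u)\<in>{q \<in> S \<times> S. (case q of (t, u) \<Rightarrow> mul t u) = s}.
            f t * g u * M (mul t u) $$ (i, j))"
      using ij by (auto simp: linear_extension_def convolution_def sum_distrib_right
          intro!: sum.cong)
    also have "\<dots> = (\<Sum>(t, u)\<in>S \<times> S. f t * g u * M (mul t u) $$ (i, j))"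
      using fin cl by (intro sum.group) auto
    also have "\<dots> = (\<Sum>t\<in>S. \<Sum>u\<in>S. \<Sum>k\<in>{0..<d}. (f t * M t $$ (i, k)) * (g u * M u $$ (k, j)))"
      unfolding sum.cartesian_product[symmetric] using ij M
      by (intro sum.cong) (auto simp: mult scalar_prod_def sum_distrib_left mult_ac carrier_matD[OF M])
    also have "\<dots> = (\<Sum>t\<in>S. \<Sum>k\<in>{0..<d}. \<Sum>u\<in>S. (f t * M t $$ (i, k)) * (g u * M u $$ (k, j)))"
      by (intro sum.cong sum.swap) auto
    also have "\<dots> = (\<Sum>k\<in>{0..<d}. \<Sum>t\<in>S. \<Sum>u\<in>S. (f t * M t $$ (i, k)) * (g u * M u $$ (k, j)))"
      by (rule sum.swap)
    also have "\<dots> = (?L f * ?L g) $$ (i, j)"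
      using ij by (simp add: linear_extension_def scalar_prod_def sum_product)
    finally show "?L (convolution S mul f g) $$ (i, j) = (?L f * ?L g) $$ (i, j)" .
  qed (auto simp: linear_extension_def)
qed (auto simp: linear_extension_def sum.distrib sum_distrib_left algebra_simps intro!: eq_matI sum.cong)

context
  fixes S :: "'a set" and mul :: "'a \<Rightarrow> 'a \<Rightarrow> 'a" and d \<rho>
  assumes rep: "representation S mul d \<rho>"
begin

lemma rep_carrier: "f \<in> semigroup_algebra S \<Longrightarrow> \<rho> f \<in> carrier_mat d d"
  using rep by (simp add: representation_def)

lemma rep_zero: "\<rho> (\<lambda>_. 0) = 0\<^sub>m d d"
proof -
  have z: "(\<lambda>_. 0) \<in> semigroup_algebra S" by (simp add: semigroup_algebra_def)
  have "\<forall>c. \<forall>f\<in>semigroup_algebra S. \<rho> (\<lambda>s. c * f s) = c \<cdot>\<^sub>m \<rho> f"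
    using rep unfolding representation_def by blast
  from bspec[OF spec[OF this, of 0] z] have "\<rho> (\<lambda>_. 0) = 0 \<cdot>\<^sub>m \<rho> (\<lambda>_. 0)" by simp
  also have "\<dots> = 0\<^sub>m d d" using rep_carrier[OF z] by auto
  finally show ?thesis .
qed

lemma rep_step:
  assumes s: "s \<in> S" and f: "f \<in> semigroup_algebra S"
  shows "\<rho> (\<lambda>t. c * point_mass s t + f t) = c \<cdot>\<^sub>m \<rho> (point_mass s) + \<rho> f"
proof -
  have "(\<lambda>t. c * point_mass s t) \<in> semigroup_algebra S"
    using s by (auto simp: semigroup_algebra_def point_mass_def)
  thus ?thesis using rep s f unfolding representation_def by simp
qed

lemma rep_point_mass_mult:
  assumes fin: "finite S" and "s \<in> S" "t \<in> S"
  shows "\<rho> (point_mass (mul s t)) = \<rho> (point_mass s) * \<rho> (point_mass t)"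
proof -
  have "convolution S mul (point_mass s) (point_mass t) x = point_mass (mul s t) x" for x
  proof -
    let ?A = "{(a, b). a \<in> S \<and> b \<in> S \<and> mul a b = x}"
    have A: "finite ?A" by (rule finite_subset[of _ "S \<times> S"]) (use fin in auto)
    have "convolution S mul (point_mass s) (point_mass t) x
        = (\<Sum>q\<in>?A. if q = (s, t) then 1 else 0)"
      unfolding convolution_def by (intro sum.cong) (auto simp: point_mass_def split: if_splits)
    also have "\<dots> = point_mass (mul s t) x"
    proof (cases "mul s t = x")
      case True
      have "(\<Sum>q\<in>?A. if q = (s, t) then 1 else (0 :: complex)) = (\<Sum>q\<in>{(s, t)}. 1)"
        using assms True by (intro sum.mono_neutral_cong_right A) (auto split: if_splits)
      thus ?thesis using True by (simp add: point_mass_def)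
    qed (auto simp: point_mass_def intro!: sum.neutral)
    finally show ?thesis .
  qed
  hence "convolution S mul (point_mass s) (point_mass t) = point_mass (mul s t)" by (rule ext)
  thus ?thesis using rep assms unfolding representation_def
    by (metis semigroup_algebra_point_mass)
qed

lemma rep_stable:
  assumes fin: "finite S" and W: "subspace_vec d W"
    and st: "\<And>s w. s \<in> S \<Longrightarrow> w \<in> W \<Longrightarrow> \<rho> (point_mass s) *\<^sub>v w \<in> W"
    and f: "f \<in> semigroup_algebra S" and w: "w \<in> W"
  shows "\<rho> f *\<^sub>v w \<in> W"
  using fin f
proof (induction f rule: semigroup_algebra_induct)
  case zero
  have "w \<in> carrier_vec d" using W w by (auto simp: subspace_vec_iff)
  hence "\<rho> (\<lambda>_. 0) *\<^sub>v w = 0\<^sub>v d" by (intro eq_vecI) (auto simp: rep_zero)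
  thus ?case using W by (simp add: subspace_vec_iff)
next
  case (step s c f)
  have [simp]: "w \<in> carrier_vec d" using W w by (auto simp: subspace_vec_iff)
  have "\<rho> (\<lambda>t. c * point_mass s t + f t) *\<^sub>v w = c \<cdot>\<^sub>v (\<rho> (point_mass s) *\<^sub>v w) + \<rho> f *\<^sub>v w"
    using step rep_carrier[of f] rep_carrier[of "point_mass s"]
    by (simp add: rep_step add_mult_distrib_mat_vec[of _ d d] smult_mult_mat_vec[of _ d d])
  thus ?case using step st[OF step(1) w] W by (simp add: subspace_vec_iff)
qed

end

lemma irreducible_linear_extension:
  assumes "finite S" "\<And>s t. s \<in> S \<Longrightarrow> t \<in> S \<Longrightarrow> mul s t \<in> S"
    and "\<And>s. s \<in> S \<Longrightarrow> M s \<in> carrier_mat d d"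
    and "\<And>s t. s \<in> S \<Longrightarrow> t \<in> S \<Longrightarrow> M (mul s t) = M s * M t"
    and "s0 \<in> S" "M s0 \<noteq> 0\<^sub>m d d"
    and "\<And>W. subspace_vec d W \<Longrightarrow> (\<And>s w. s \<in> S \<Longrightarrow> w \<in> W \<Longrightarrow> M s *\<^sub>v w \<in> W) \<Longrightarrow>
      W \<noteq> {0\<^sub>v d} \<Longrightarrow> W = carrier_vec d"
  shows "irreducible_representation S mul d (linear_extension S d M)"
  unfolding irreducible_representation_def
proof (intro conjI allI impI)
  show "representation S mul d (linear_extension S d M)"
    using assms by (intro representation_linear_extension) auto
  have L: "linear_extension S d M (point_mass s) = M s" if "s \<in> S" for s
    using assms that by (intro linear_extension_point_mass) auto
  show "\<exists>f\<in>semigroup_algebra S. linear_extension S d M f \<noteq> 0\<^sub>m d d"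
    using assms(5,6) by (intro bexI[of _ "point_mass s0"]) (auto simp: L)
  fix W assume W: "subspace_vec d W \<and>
    (\<forall>f\<in>semigroup_algebra S. \<forall>w\<in>W. linear_extension S d M f *\<^sub>v w \<in> W)"
  hence "M s *\<^sub>v w \<in> W" if "s \<in> S" "w \<in> W" for s w
    using that L[of s] by (metis semigroup_algebra_point_mass)
  thus "W = {0\<^sub>v d} \<or> W = carrier_vec d" using W assms(7) by blast
qed

context
  fixes S :: "'a set" and mul :: "'a \<Rightarrow> 'a \<Rightarrow> 'a" and d \<rho>
  assumes irr: "irreducible_representation S mul d \<rho>" and fin: "finite S"
begin

lemma irr_rep: "representation S mul d \<rho>"
  using irr by (simp add: irreducible_representation_def)

lemma irr_carrier: "s \<in> S \<Longrightarrow> \<rho> (point_mass s) \<in> carrier_mat d d"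
  by (rule rep_carrier[OF irr_rep]) simp

lemma irr_subspace:
  assumes W: "subspace_vec d W" and st: "\<And>s w. s \<in> S \<Longrightarrow> w \<in> W \<Longrightarrow> \<rho> (point_mass s) *\<^sub>v w \<in> W"
    and "W \<noteq> {0\<^sub>v d}"
  shows "W = carrier_vec d"
  using irr rep_stable[OF irr_rep fin W st] assms unfolding irreducible_representation_def by blast

lemma irr_point_mass_nonzero: "\<exists>s\<in>S. \<rho> (point_mass s) \<noteq> 0\<^sub>m d d"
proof (rule ccontr)
  assume n: "\<not> (\<exists>s\<in>S. \<rho> (point_mass s) \<noteq> 0\<^sub>m d d)"
  have "\<rho> f = 0\<^sub>m d d" if "f \<in> semigroup_algebra S" for f
    using fin that
    by (induction f rule: semigroup_algebra_induct)
      (use n in \<open>auto simp: rep_zero[OF irr_rep] rep_step[OF irr_rep]\<close>)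
  thus False using irr unfolding irreducible_representation_def by blast
qed

end

section \<open>Schur's lemma and equivalence of representations\<close>

lemma col_mult_unit_vec:
  assumes "(A :: complex mat) \<in> carrier_mat m n" "j < n"
  shows "A *\<^sub>v unit_vec n j = col A j"
  using assms by (intro eq_vecI) (auto simp: scalar_prod_right_unit)

lemma mat_zero_if_mult_vec_zero:
  assumes A: "(A :: complex mat) \<in> carrier_mat m n" and z: "\<And>v. v \<in> carrier_vec n \<Longrightarrow> A *\<^sub>v v = 0\<^sub>v m"
  shows "A = 0\<^sub>m m n"
proof (rule eq_matI)
  fix i j assume ij: "i < dim_row (0\<^sub>m m n)" "j < dim_col (0\<^sub>m m n)"
  hence "col A j = 0\<^sub>v m" using col_mult_unit_vec[OF A, of j] z[of "unit_vec n j"] by simp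
  hence "col A j $ i = 0" using ij by simp
  thus "A $$ (i, j) = 0\<^sub>m m n $$ (i, j)" using ij A by simp
qed (use A in auto)

text \<open>The kernel of \<open>T\<close> is stable under \<open>\<rho>'\<close> and the range of
  \<open>T\<close> is stable under \<open>\<rho>\<close>. As \<open>T\<close> is nonzero,
  irreducibility makes the kernel zero and the range everything, so \<open>T\<close> is
  invertible.\<close>

lemma schur:
  assumes fin: "finite S"
    and 1: "irreducible_representation S mul d \<rho>" and 2: "irreducible_representation S mul d' \<rho>'"
    and T: "T \<in> carrier_mat d d'" and T0: "T \<noteq> 0\<^sub>m d d'"
    and int: "\<And>s. s \<in> S \<Longrightarrow> \<rho> (point_mass s) * T = T * \<rho>' (point_mass s)"
  shows "equivalent_representations S (d, \<rho>) (d', \<rho>')"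
proof -
  note r1 = irr_rep[OF 1 fin] and r2 = irr_rep[OF 2 fin]
  note c1 = irr_carrier[OF 1 fin] and c2 = irr_carrier[OF 2 fin]
  have intv: "\<rho> (point_mass s) *\<^sub>v (T *\<^sub>v v) = T *\<^sub>v (\<rho>' (point_mass s) *\<^sub>v v)"
    if "s \<in> S" "v \<in> carrier_vec d'" for s v
    using that int[OF that(1)] c1 c2 T
    by (simp add: assoc_mult_mat_vec[symmetric, of _ d d _ d'] assoc_mult_mat_vec[symmetric, of _ d d' _ d'])
  have ker: "v = 0\<^sub>v d'" if v: "v \<in> carrier_vec d'" "T *\<^sub>v v = 0\<^sub>v d" for v
  proof -
    let ?K = "{v \<in> carrier_vec d'. T *\<^sub>v v = 0\<^sub>v d}"
    have "subspace_vec d' ?K" using T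
      by (auto simp: subspace_vec_iff mult_add_distrib_mat_vec[of _ d d'] mult_mat_vec[of _ d d'])
    moreover have "\<rho>' (point_mass s) *\<^sub>v w \<in> ?K" if "s \<in> S" "w \<in> ?K" for s w
    proof -
      have "\<rho> (point_mass s) *\<^sub>v 0\<^sub>v d = 0\<^sub>v d" using c1[OF that(1)] by auto
      thus ?thesis using that intv[of s w] c2[OF that(1)] by auto
    qed
    moreover have "?K \<noteq> carrier_vec d'"
      using mat_zero_if_mult_vec_zero[OF T] T0 by blast
    ultimately have "?K = {0\<^sub>v d'}" using irr_subspace[OF 2 fin, of ?K] by blast
    thus ?thesis using v by blast
  qed
  let ?R = "(\<lambda>v. T *\<^sub>v v) ` carrier_vec d'"
  have "subspace_vec d ?R"
    unfolding subspace_vec_iff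
  proof (intro conjI ballI allI)
    show "0\<^sub>v d \<in> ?R" using T by (intro image_eqI[of _ _ "0\<^sub>v d'"]) auto
    show "?R \<subseteq> carrier_vec d" using T by auto
    fix v w assume "v \<in> ?R" "w \<in> ?R"
    thus "v + w \<in> ?R" using T by (auto simp flip: mult_add_distrib_mat_vec[of _ d d'])
  next
    fix c v assume "v \<in> ?R"
    thus "c \<cdot>\<^sub>v v \<in> ?R" using T by (auto simp flip: mult_mat_vec[of _ d d'])
  qed
  moreover have "\<rho> (point_mass s) *\<^sub>v w \<in> ?R" if "s \<in> S" "w \<in> ?R" for s w
    using that intv c2[OF that(1)] by auto
  moreover have "?R \<noteq> {0\<^sub>v d}" using mat_zero_if_mult_vec_zero[OF T] T0 by blast
  ultimately have R: "?R = carrier_vec d" by (rule irr_subspace[OF 1 fin])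
  \<comment> \<open>Preimages of the unit vectors serve as the columns of a right inverse
    \<open>B\<close>.\<close>
  have "\<exists>w. w \<in> carrier_vec d' \<and> T *\<^sub>v w = unit_vec d j" if "j < d" for j
  proof -
    have "unit_vec d j \<in> ?R" unfolding R using that by simp
    thus ?thesis by force
  qed
  then obtain w where w: "\<And>j. j < d \<Longrightarrow> w j \<in> carrier_vec d'" "\<And>j. j < d \<Longrightarrow> T *\<^sub>v w j = unit_vec d j"
    by metis
  define B where "B = mat d' d (\<lambda>(i, j). w j $ i)"
  have B: "B \<in> carrier_mat d' d" by (simp add: B_def)
  have cB: "col B j = w j" if "j < d" for j using w(1)[OF that] that by (auto simp: B_def)
  have TB: "T * B = 1\<^sub>m d"
  proof (rule mat_col_eqI)
    fix j assume "j < dim_col (1\<^sub>m d)"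
    hence j: "j < d" by simp
    have "col (T * B) j = T *\<^sub>v col B j" using T B j by (rule col_mult2)
    also have "\<dots> = unit_vec d j" by (simp only: cB[OF j] w(2)[OF j])
    finally show "col (T * B) j = col (1\<^sub>m d) j" using j by simp
  qed (use T B in auto)
  \<comment> \<open>\<open>T\<close> annihilates the columns of this difference and is injective.
    Having a two-sided inverse then forces \<open>d = d'\<close>.\<close>
  have "B * T - 1\<^sub>m d' = 0\<^sub>m d' d'"
  proof (rule mat_zero_if_mult_vec_zero)
    show c: "B * T - 1\<^sub>m d' \<in> carrier_mat d' d'" using B T by auto
    fix v :: "complex vec" assume v: "v \<in> carrier_vec d'"
    have "T * (B * T - 1\<^sub>m d') = (T * B) * T - T"
      using T B by (simp add: mult_minus_distrib_mat[of _ d d' _ d'])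
    also have "\<dots> = 0\<^sub>m d d'" using T by (simp add: TB)
    finally have "T *\<^sub>v ((B * T - 1\<^sub>m d') *\<^sub>v v) = 0\<^sub>v d"
      using T B v by (subst assoc_mult_mat_vec[symmetric, of _ d d' _ d']) auto
    thus "(B * T - 1\<^sub>m d') *\<^sub>v v = 0\<^sub>v d'" using ker[of "(B * T - 1\<^sub>m d') *\<^sub>v v"] mult_mat_vec_carrier[OF c v] by simp
  qed
  hence BT: "B * T = 1\<^sub>m d'"
  proof -
    assume z: "B * T - 1\<^sub>m d' = 0\<^sub>m d' d'"
    have "(B * T) $$ (i, j) = 1\<^sub>m d' $$ (i, j)" if "i < d'" "j < d'" for i j
      using arg_cong[OF z, of "\<lambda>M. M $$ (i, j)"] that by simp
    thus ?thesis using B T by (intro eq_matI) auto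
  qed
  have dd: "d = d'"
    using left_inverse_dim_le[OF T B TB] left_inverse_dim_le[OF B T BT] by simp
  have "\<rho> f * T = T * \<rho>' f" if "f \<in> semigroup_algebra S" for f
    using fin that
  proof (induction f rule: semigroup_algebra_induct)
    case zero
    thus ?case using T by (simp add: rep_zero[OF r1] rep_zero[OF r2])
  next
    case (step s c f)
    thus ?case using T c1[OF step(1)] c2[OF step(1)] rep_carrier[OF r1 step(2)] rep_carrier[OF r2 step(2)]
      by (simp add: rep_step[OF r1] rep_step[OF r2] int
          add_mult_distrib_mat[of _ d d _ _ d'] mult_add_distrib_mat[of _ d d' _ d']
          mult_smult_assoc_mat[of _ d d _ d'] mult_smult_distrib[of _ d d' _ d'])
  qed
  moreover have "\<rho> f = \<rho> f * T * B" if "f \<in> semigroup_algebra S" for f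
    using rep_carrier[OF r1 that] T B by (simp add: assoc_mult_mat[of _ d d _ d' _ d] TB)
  ultimately have "\<rho> f = T * \<rho>' f * B" if "f \<in> semigroup_algebra S" for f
    using that by metis
  hence "similar_mat_wit (\<rho> f) (\<rho>' f) T B" if "f \<in> semigroup_algebra S" for f
    using that TB BT T B rep_carrier[OF r1 that] rep_carrier[OF r2 that] dd
    by (intro similar_mat_witI[of _ _ d]) auto
  thus ?thesis unfolding equivalent_representations_def using dd by auto
qed

text \<open>Turns the similarities of the definition into an intertwining relation on basis
  elements, the form that can be compared entry by entry and fed back into
  \<open>schur\<close>.\<close>

lemma equivalent_intertwiner:
  assumes fin: "finite S" and 1: "irreducible_representation S mul d \<rho>"
    and eq: "equivalent_representations S (d, \<rho>) (d', \<rho>')"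
  obtains P Q where "d' = d" "P \<in> carrier_mat d d" "Q \<in> carrier_mat d d"
    "P * Q = 1\<^sub>m d" "Q * P = 1\<^sub>m d"
    "\<And>s. s \<in> S \<Longrightarrow> \<rho> (point_mass s) * P = P * \<rho>' (point_mass s)"
proof -
  obtain P Q where PQ: "\<And>f. f \<in> semigroup_algebra S \<Longrightarrow> similar_mat_wit (\<rho> f) (\<rho>' f) P Q"
    and d: "d' = d" using eq unfolding equivalent_representations_def by auto
  \<comment> \<open>The sizes of \<open>P\<close> and \<open>Q\<close> and their being inverse are
    read off at one element of \<open>S\<close>; there is one because \<open>\<rho>\<close> is
    nonzero.\<close>
  obtain s0 where s0: "s0 \<in> S" using irr_point_mass_nonzero[OF 1 fin] by auto
  note w = similar_mat_witD2[OF irr_carrier[OF 1 fin] PQ[OF semigroup_algebra_point_mass]]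
  have "\<rho> (point_mass s) * P = P * \<rho>' (point_mass s)" if s: "s \<in> S" for s
  proof -
    have "\<rho> (point_mass s) * P = P * \<rho>' (point_mass s) * Q * P" using w(3)[OF s s] by simp
    also have "\<dots> = P * \<rho>' (point_mass s) * (Q * P)"
      using w(5-7)[OF s s] by (intro assoc_mult_mat[of _ d d _ d _ d]) auto
    finally show ?thesis using w(2,5-7)[OF s s] by simp
  qed
  thus ?thesis using that[of P Q] d w[OF s0 s0] by auto
qed

text \<open>Passing from the first representation to \<open>\<rho>\<close> and on to the second
  gives the intertwiner \<open>Q * P'\<close>. It is a product of invertible matrices and the
  dimension is not zero, so \<open>schur\<close> applies.\<close>

lemma equivalent_representations_common:
  assumes fin: "finite S" and 1: "irreducible_representation S mul d \<rho>"
    and 2: "irreducible_representation S mul d1 \<rho>1" and 3: "irreducible_representation S mul d2 \<rho>2"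
    and eq: "equivalent_representations S (d, \<rho>) (d1, \<rho>1)" "equivalent_representations S (d, \<rho>) (d2, \<rho>2)"
  shows "equivalent_representations S (d1, \<rho>1) (d2, \<rho>2)"
proof -
  obtain P Q where a: "d1 = d" "P \<in> carrier_mat d d" "Q \<in> carrier_mat d d"
    "P * Q = 1\<^sub>m d" "Q * P = 1\<^sub>m d"
    "\<And>s. s \<in> S \<Longrightarrow> \<rho> (point_mass s) * P = P * \<rho>1 (point_mass s)"
    using equivalent_intertwiner[OF fin 1 eq(1)] by metis
  obtain P' Q' where b: "d2 = d" "P' \<in> carrier_mat d d" "Q' \<in> carrier_mat d d"
    "P' * Q' = 1\<^sub>m d" "Q' * P' = 1\<^sub>m d"
    "\<And>s. s \<in> S \<Longrightarrow> \<rho> (point_mass s) * P' = P' * \<rho>2 (point_mass s)"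
    using equivalent_intertwiner[OF fin 1 eq(2)] by metis
  show ?thesis
  proof (rule schur[OF fin 2 3, of "Q * P'"])
    show "Q * P' \<in> carrier_mat d1 d2" using a b by auto
    fix s assume s: "s \<in> S"
    note c = irr_carrier[OF 1 fin s] irr_carrier[OF 2 fin s] irr_carrier[OF 3 fin s]
    let ?m = "\<rho> (point_mass s)" and ?m1 = "\<rho>1 (point_mass s)" and ?m2 = "\<rho>2 (point_mass s)"
    have "?m1 * Q = (Q * P) * ?m1 * Q" using a c by (simp del: assoc_mult_mat)
    also have "\<dots> = Q * (P * ?m1) * Q" using a(1-3) c by simp
    also have "\<dots> = Q * (?m * P) * Q" using a(6)[OF s] by simp
    also have "\<dots> = Q * ?m * (P * Q)" using a c by (simp add: assoc_mult_mat[of _ d d _ d _ d])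
    finally have q: "?m1 * Q = Q * ?m" using a c by simp
    have "?m1 * (Q * P') = (?m1 * Q) * P'" using a b c by (simp add: assoc_mult_mat[of _ d d _ d _ d])
    also have "\<dots> = Q * (?m * P')" unfolding q using a b c by (simp add: assoc_mult_mat[of _ d d _ d _ d])
    also have "\<dots> = (Q * P') * ?m2" unfolding b(6)[OF s] using a b c
      by (simp add: assoc_mult_mat[of _ d d _ d _ d])
    finally show "?m1 * (Q * P') = (Q * P') * ?m2" .
  next
    show "Q * P' \<noteq> 0\<^sub>m d1 d2"
    proof
      assume z: "Q * P' = 0\<^sub>m d1 d2"
      have "1\<^sub>m d = P * (Q * P') * Q'" using a b by (simp add: assoc_mult_mat[of _ d d _ d _ d, symmetric])
      also have "\<dots> = 0\<^sub>m d d" unfolding z using a b by simp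
      finally have o: "1\<^sub>m d = (0\<^sub>m d d :: complex mat)" .
      obtain s where s: "s \<in> S" "\<rho> (point_mass s) \<noteq> 0\<^sub>m d d"
        using irr_point_mass_nonzero[OF 1 fin] by auto
      have "\<rho> (point_mass s) = \<rho> (point_mass s) * 1\<^sub>m d" using irr_carrier[OF 1 fin s(1)] by simp
      also have "\<dots> = 0\<^sub>m d d" unfolding o using irr_carrier[OF 1 fin s(1)] by simp
      finally show False using s(2) by simp
    qed
  qed
qed

lemma equivalent_representations_refl:
  assumes "representation S mul d \<rho>"
  shows "equivalent_representations S (d, \<rho>) (d, \<rho>)"
proof -
  have "similar_mat_wit (\<rho> f) (\<rho> f) (1\<^sub>m d) (1\<^sub>m d)" if "f \<in> semigroup_algebra S" for f
    by (rule similar_mat_wit_refl[OF rep_carrier[OF assms that]])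
  thus ?thesis unfolding equivalent_representations_def by auto
qed

section \<open>Induced representations\<close>

lemma sum_div_mod:
  fixes f :: "nat \<Rightarrow> nat \<Rightarrow> complex"
  assumes "0 < d"
  shows "(\<Sum>l\<in>{0..<r * d}. f (l div d) (l mod d)) = (\<Sum>a\<in>{0..<r}. \<Sum>i\<in>{0..<d}. f a i)"
proof -
  have *: "a * d + i < r * d" if "a < r" "i < d" for a i
  proof -
    have "a * d + i < (a + 1) * d" using that by simp
    also have "\<dots> \<le> r * d" using that by (intro mult_le_mono1) simp
    finally show ?thesis .
  qed
  have "(\<Sum>(a, i)\<in>{0..<r} \<times> {0..<d}. f a i) = (\<Sum>l\<in>{0..<r * d}. f (l div d) (l mod d))"
    by (rule sum.reindex_bij_witness[of _ "\<lambda>l. (l div d, l mod d)" "\<lambda>(a, i). a * d + i"])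
      (use assms * in \<open>auto simp: less_mult_imp_div_less\<close>)
  thus ?thesis by (simp add: sum.cartesian_product)
qed

context d_class
begin

text \<open>An index \<open>l\<close> stands for the coordinate \<open>l mod d\<close> in copy
  number \<open>l div d\<close> of the space of the group representation.\<close>

definition induced :: "nat \<Rightarrow> ('a \<Rightarrow> complex mat) \<Rightarrow> 'a \<Rightarrow> complex mat" where
  "induced d M t = mat (r * d) (r * d) (\<lambda>(i, j).
     let g = coord (i div d) (j div d) t in if g \<in> G then M g $$ (i mod d, j mod d) else 0)"

definition induced_representation ::
    "nat \<Rightarrow> (('a \<Rightarrow> complex) \<Rightarrow> complex mat) \<Rightarrow> ('a \<Rightarrow> complex) \<Rightarrow> complex mat" where
  "induced_representation d \<rho> = linear_extension S (r * d) (induced d (\<lambda>g. \<rho> (point_mass g)))"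

lemma induced_carrier [simp]: "induced d M t \<in> carrier_mat (r * d) (r * d)"
  by (simp add: induced_def)

lemma induced_dim [simp]: "dim_row (induced d M t) = r * d" "dim_col (induced d M t) = r * d"
  by (simp_all add: induced_def)

lemma induced_entry:
  "i < r * d \<Longrightarrow> j < r * d \<Longrightarrow> induced d M t $$ (i, j) =
    (if coord (i div d) (j div d) t \<in> G
     then M (coord (i div d) (j div d) t) $$ (i mod d, j mod d) else 0)"
  by (simp add: induced_def Let_def)

lemma induced_representation_point_mass:
  "s \<in> S \<Longrightarrow> induced_representation d \<rho> (point_mass s) = induced d (\<lambda>g. \<rho> (point_mass g)) s"
  unfolding induced_representation_def by (intro linear_extension_point_mass fin) auto

text \<open>In block column \<open>c\<close> of the matrix of \<open>u\<close> at most one block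
  \<open>b\<close> is nonzero. If there is one, the sum over blocks collapses to it and
  \<open>coord_mul\<close> applies; if there is none, both sides vanish by
  \<open>coord_mul_none\<close>.\<close>

lemma induced_mult:
  assumes d: "0 < d" and M: "\<And>g. g \<in> G \<Longrightarrow> M g \<in> carrier_mat d d"
    and mult: "\<And>g h. g \<in> G \<Longrightarrow> h \<in> G \<Longrightarrow> M (g \<cdot> h) = M g * M h"
    and [simp]: "t \<in> S" "u \<in> S"
  shows "induced d M (t \<cdot> u) = induced d M t * induced d M u"
proof (rule eq_matI)
  fix i j assume "i < dim_row (induced d M t * induced d M u)" "j < dim_col (induced d M t * induced d M u)"
  hence ij: "i < r * d" "j < r * d" by simp_all
  define a c i' j' where abbrs: "a = i div d" "c = j div d" "i' = i mod d" "j' = j mod d"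
  have ac [simp]: "a < r" "c < r" "i' < d" "j' < d"
    using ij d by (auto simp: abbrs less_mult_imp_div_less)
  define X where "X b l = (if coord a b t \<in> G then M (coord a b t) $$ (i', l) else 0)" for b l
  define Y where "Y b l = (if coord b c u \<in> G then M (coord b c u) $$ (l, j') else 0)" for b l
  have "(induced d M t * induced d M u) $$ (i, j)
      = (\<Sum>l\<in>{0..<r * d}. X (l div d) (l mod d) * Y (l div d) (l mod d))"
    using ij unfolding X_def Y_def abbrs by (simp add: scalar_prod_def induced_entry)
  also have "\<dots> = (\<Sum>b\<in>{0..<r}. \<Sum>l\<in>{0..<d}. X b l * Y b l)"
    by (rule sum_div_mod[OF d, of "\<lambda>b l. X b l * Y b l"])
  also have "\<dots> = induced d M (t \<cdot> u) $$ (i, j)"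
  proof (cases "\<exists>b<r. coord b c u \<in> G")
    case True
    then obtain b where b: "b < r" "coord b c u \<in> G" by blast
    have Y0: "Y b' l = 0" if "b' < r" "b' \<noteq> b" for b' l
      using coord_unique[of b' b c u] that b by (auto simp: Y_def)
    have "(\<Sum>b\<in>{0..<r}. \<Sum>l\<in>{0..<d}. X b l * Y b l) = (\<Sum>b\<in>{b}. \<Sum>l\<in>{0..<d}. X b l * Y b l)"
      using b Y0 by (intro sum.mono_neutral_right) auto
    also have "\<dots> = (if coord a b t \<in> G then (M (coord a b t) * M (coord b c u)) $$ (i', j') else 0)"
      using b M by (auto simp: X_def Y_def scalar_prod_def carrier_matD[OF M])
    also have "\<dots> = (if coord a c (t \<cdot> u) \<in> G then M (coord a c (t \<cdot> u)) $$ (i', j') else 0)"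
    proof -
      have iff: "coord a c (t \<cdot> u) \<in> G \<longleftrightarrow> coord a b t \<in> G"
        using b by (intro coord_mul_iff) auto
      show ?thesis unfolding iff using b by (simp add: coord_mul[of a b c] mult)
    qed
    finally show ?thesis using ij by (simp add: induced_entry abbrs)
  next
    case False
    hence "coord a c (t \<cdot> u) \<notin> G" by (intro coord_mul_none) auto
    thus ?thesis using False ij by (simp add: Y_def induced_entry flip: abbrs)
  qed
  finally show "induced d M (t \<cdot> u) $$ (i, j) = (induced d M t * induced d M u) $$ (i, j)" ..
qed auto

lemma induced_unit_entry:
  assumes "a < r" "b < r" "g \<in> G" "i < r * d" "j < r * d"
  shows "induced d M (p a \<cdot> g \<cdot> (p b)\<^sup>\<star>) $$ (i, j) =
    (if i div d = a \<and> j div d = b then M g $$ (i mod d, j mod d) else 0)"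
  using assms coord_unit_iff[of a b "i div d" "j div d" g] coord_unit_in[of a b g]
  by (auto simp: induced_entry less_mult_imp_div_less)

lemma induced_nonzero:
  assumes "induced d M t \<noteq> 0\<^sub>m (r * d) (r * d)"
  shows "\<exists>i<r. \<exists>j<r. coord i j t \<in> G"
proof (rule ccontr)
  assume n: "\<not> ?thesis"
  have "induced d M t = 0\<^sub>m (r * d) (r * d)"
    by (rule eq_matI) (use n in \<open>auto simp: induced_entry less_mult_imp_div_less\<close>)
  thus False using assms by simp
qed

lemma r_pos: "0 < r"
  using p_cover[of e] by (auto simp: Suc_le_eq)

section \<open>Irreducibility of the induced representations\<close>

context
  fixes d :: nat and \<rho> :: "('a \<Rightarrow> complex) \<Rightarrow> complex mat"
  assumes irr: "irreducible_representation G mul d \<rho>"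
begin

abbreviation "M g \<equiv> \<rho> (point_mass g)"

lemma M_carrier: "g \<in> G \<Longrightarrow> M g \<in> carrier_mat d d"
  by (rule irr_carrier[OF irr finite_G])

lemma M_mult: "g \<in> G \<Longrightarrow> h \<in> G \<Longrightarrow> M (g \<cdot> h) = M g * M h"
  by (rule rep_point_mass_mult[OF irr_rep[OF irr finite_G] finite_G])

lemma dim_pos: "0 < d"
proof (rule ccontr)
  assume "\<not> 0 < d"
  hence "M g = 0\<^sub>m d d" if "g \<in> G" for g using M_carrier[OF that] by (intro eq_matI) auto
  thus False using irr_point_mass_nonzero[OF irr finite_G] by blast
qed

text \<open>Representations are not assumed to be unital, so this needs irreducibility: the vectors
  fixed by \<open>M e\<close> form a submodule that contains every \<open>M g *\<^sub>v w\<close>,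
  and it is nonzero because some \<open>M g\<close> is.\<close>

lemma M_e: "M e = 1\<^sub>m d"
proof -
  note c = M_carrier[OF e_in_G]
  let ?W = "{v \<in> carrier_vec d. M e *\<^sub>v v = v}"
  have "subspace_vec d ?W" using c
    by (auto simp: subspace_vec_iff mult_add_distrib_mat_vec[of _ d d] mult_mat_vec[of _ d d])
  moreover have fixed: "M g *\<^sub>v w \<in> ?W" if "g \<in> G" "w \<in> carrier_vec d" for g w
    using that M_mult[of e g] M_carrier[OF that(1)] c
    by (simp add: assoc_mult_mat_vec[of _ d d _ d, symmetric])
  hence "\<And>g w. g \<in> G \<Longrightarrow> w \<in> ?W \<Longrightarrow> M g *\<^sub>v w \<in> ?W" by blast
  moreover have "?W \<noteq> {0\<^sub>v d}"
  proof
    assume W: "?W = {0\<^sub>v d}"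
    have "M g = 0\<^sub>m d d" if "g \<in> G" for g
      using fixed[OF that] W by (intro mat_zero_if_mult_vec_zero M_carrier that) blast
    thus False using irr_point_mass_nonzero[OF irr finite_G] by blast
  qed
  ultimately have W: "?W = carrier_vec d" by (rule irr_subspace[OF irr finite_G])
  show ?thesis
  proof (rule mat_col_eqI)
    fix j assume "j < dim_col (1\<^sub>m d)"
    hence j: "j < d" by simp
    have "unit_vec d j \<in> ?W" unfolding W by simp
    thus "col (M e) j = col (1\<^sub>m d) j" using j c by (simp add: col_mult_unit_vec)
  qed (use c in auto)
qed

abbreviation "N t \<equiv> induced d (\<lambda>g. \<rho> (point_mass g)) t"

lemma N_mult: "t \<in> S \<Longrightarrow> u \<in> S \<Longrightarrow> N (t \<cdot> u) = N t * N u"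
  by (intro induced_mult dim_pos M_carrier M_mult)

lemma N_unit_nonzero: "N (p 0 \<cdot> e \<cdot> (p 0)\<^sup>\<star>) \<noteq> 0\<^sub>m (r * d) (r * d)"
proof
  assume z: "N (p 0 \<cdot> e \<cdot> (p 0)\<^sup>\<star>) = 0\<^sub>m (r * d) (r * d)"
  have "N (p 0 \<cdot> e \<cdot> (p 0)\<^sup>\<star>) $$ (0, 0) = 1"
    using dim_pos r_pos by (simp add: induced_unit_entry M_e del: p_mul_e)
  thus False using dim_pos r_pos by (simp add: z del: p_mul_e)
qed

text \<open>\<open>e\<close> is a factor of the matrix unit
  \<open>p 0 \<cdot> e \<cdot> (p 0)\<^sup>\<star>\<close>, whose image contains the identity block
  \<open>M e\<close>.\<close>

lemma N_e_nonzero: "N e \<noteq> 0\<^sub>m (r * d) (r * d)"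
proof
  assume z: "N e = 0\<^sub>m (r * d) (r * d)"
  have "N (p 0 \<cdot> e \<cdot> (p 0)\<^sup>\<star>) = N (p 0) * N e * N ((p 0)\<^sup>\<star>)"
    using r_pos by (simp add: N_mult del: p_mul_e)
  also have "\<dots> = 0\<^sub>m (r * d) (r * d)" unfolding z
    by (simp add: right_mult_zero_mat[of _ _ "r * d"] left_mult_zero_mat[of _ "r * d"])
  finally show False using N_unit_nonzero by contradiction
qed

definition embed :: "nat \<Rightarrow> complex vec \<Rightarrow> complex vec" where
  "embed a c = vec (r * d) (\<lambda>l. if l div d = a then c $ (l mod d) else 0)"

definition project :: "nat \<Rightarrow> complex vec \<Rightarrow> complex vec" where
  "project a w = vec d (\<lambda>i. w $ (a * d + i))"

lemma block_index: "a < r \<Longrightarrow> i < d \<Longrightarrow> a * d + i < r * d"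
proof -
  assume "a < r" "i < d"
  hence "a * d + i < (a + 1) * d" "(a + 1) * d \<le> r * d" by (simp, intro mult_le_mono1) simp
  thus ?thesis by simp
qed

lemma project_embed: "a < r \<Longrightarrow> c \<in> carrier_vec d \<Longrightarrow> project a (embed a c) = c"
  using dim_pos by (intro eq_vecI) (auto simp: project_def embed_def block_index)

lemma N_unit_mult_vec:
  assumes ab: "a < r" "b < r" and g: "g \<in> G" and w: "w \<in> carrier_vec (r * d)"
  shows "N (p b \<cdot> g \<cdot> (p a)\<^sup>\<star>) *\<^sub>v w = embed b (M g *\<^sub>v project a w)"
proof (rule eq_vecI)
  fix i assume "i < dim_vec (embed b (M g *\<^sub>v project a w))"
  hence i: "i < r * d" by (simp add: embed_def)
  have "(N (p b \<cdot> g \<cdot> (p a)\<^sup>\<star>) *\<^sub>v w) $ i = (\<Sum>l\<in>{0..<r * d}.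
      (if i div d = b \<and> l div d = a then M g $$ (i mod d, l mod d) else 0) * w $ (l div d * d + l mod d))"
    using i w ab g by (simp add: scalar_prod_def induced_unit_entry)
  also have "\<dots> = (\<Sum>c\<in>{0..<r}. \<Sum>l\<in>{0..<d}.
      (if i div d = b \<and> c = a then M g $$ (i mod d, l) else 0) * w $ (c * d + l))"
    by (rule sum_div_mod[OF dim_pos, of "\<lambda>c l.
      (if i div d = b \<and> c = a then M g $$ (i mod d, l) else 0) * w $ (c * d + l)"])
  also have "\<dots> = (\<Sum>c\<in>{a}. \<Sum>l\<in>{0..<d}.
      (if i div d = b \<and> c = a then M g $$ (i mod d, l) else 0) * w $ (c * d + l))"
    using ab by (intro sum.mono_neutral_right) auto
  also have "\<dots> = embed b (M g *\<^sub>v project a w) $ i"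
    using i dim_pos M_carrier[OF g] by (auto simp: embed_def project_def scalar_prod_def)
  finally show "(N (p b \<cdot> g \<cdot> (p a)\<^sup>\<star>) *\<^sub>v w) $ i = embed b (M g *\<^sub>v project a w) $ i" .
qed (simp add: embed_def)

text \<open>A nonzero vector of \<open>W\<close> has a nonzero component in some copy
  \<open>a\<close>, and matrix units isolate it inside \<open>W\<close>. The vectors whose embedding
  into copy \<open>a\<close> lies in \<open>W\<close> form a nonzero submodule for \<open>G\<close>,
  hence everything, and matrix units carry them into all other copies.\<close>

lemma irreducible_induced:
  "irreducible_representation S mul (r * d) (induced_representation d \<rho>)"
  unfolding induced_representation_def
proof (rule irreducible_linear_extension)
  show "p 0 \<cdot> e \<cdot> (p 0)\<^sup>\<star> \<in> S" using r_pos by simp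
  show "N (p 0 \<cdot> e \<cdot> (p 0)\<^sup>\<star>) \<noteq> 0\<^sub>m (r * d) (r * d)" by (rule N_unit_nonzero)
  fix W assume W: "subspace_vec (r * d) W"
    and st: "\<And>s w. s \<in> S \<Longrightarrow> w \<in> W \<Longrightarrow> N s *\<^sub>v w \<in> W" and W0: "W \<noteq> {0\<^sub>v (r * d)}"
  obtain w where w: "w \<in> W" "w \<noteq> 0\<^sub>v (r * d)" using W W0 by (auto simp: subspace_vec_iff)
  have wc: "w \<in> carrier_vec (r * d)" using w W by (auto simp: subspace_vec_iff)
  then obtain l where l: "l < r * d" "w $ l \<noteq> 0"
    using w(2) by (metis carrier_vecD eq_vecI index_zero_vec)
  define a where "a = l div d"
  have a: "a < r" using l by (simp add: a_def less_mult_imp_div_less)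
  have unit_W: "embed b (M g *\<^sub>v project a v) \<in> W" if "b < r" "g \<in> G" "v \<in> W" for b g v
  proof -
    have vc: "v \<in> carrier_vec (r * d)" using that W by (auto simp: subspace_vec_iff)
    have "p b \<cdot> g \<cdot> (p a)\<^sup>\<star> \<in> S" using that a by (simp add: G_in)
    from st[OF this that(3)] show ?thesis unfolding N_unit_mult_vec[OF a that(1,2) vc] .
  qed
  let ?V = "{c \<in> carrier_vec d. embed a c \<in> W}"
  have pc [simp]: "project a v \<in> carrier_vec d" for v by (simp add: project_def)
  have ec: "embed a c \<in> carrier_vec (r * d)" for c by (simp add: embed_def)
  have "subspace_vec d ?V"
    unfolding subspace_vec_iff
  proof (intro conjI ballI allI)
    have "embed a (0\<^sub>v d) = 0\<^sub>v (r * d)" using dim_pos by (intro eq_vecI) (auto simp: embed_def)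
    thus "0\<^sub>v d \<in> ?V" using W by (simp add: subspace_vec_iff)
  next
    fix v v' assume v: "v \<in> ?V" "v' \<in> ?V"
    have "embed a (v + v') = embed a v + embed a v'"
      using dim_pos v by (intro eq_vecI) (auto simp: embed_def)
    thus "v + v' \<in> ?V" using W v by (simp add: subspace_vec_iff)
  next
    fix c v assume v: "v \<in> ?V"
    have "embed a (c \<cdot>\<^sub>v v) = c \<cdot>\<^sub>v embed a v"
      using dim_pos v by (intro eq_vecI) (auto simp: embed_def)
    thus "c \<cdot>\<^sub>v v \<in> ?V" using W v by (simp add: subspace_vec_iff)
  qed auto
  moreover have "M g *\<^sub>v c \<in> ?V" if "g \<in> G" "c \<in> ?V" for g c
    using unit_W[OF a that(1), of "embed a c"] that M_carrier[OF that(1)] project_embed[OF a, of c]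
    by simp
  moreover have "?V \<noteq> {0\<^sub>v d}"
  proof -
    have "project a w $ (l mod d) \<noteq> 0" using l dim_pos by (simp add: project_def a_def)
    hence "project a w \<noteq> 0\<^sub>v d" using dim_pos by (metis index_zero_vec(1) mod_less_divisor)
    moreover have "project a w \<in> ?V" using unit_W[OF a e_in_G w(1)] by (simp add: M_e)
    ultimately show ?thesis by blast
  qed
  ultimately have V: "?V = carrier_vec d" by (rule irr_subspace[OF irr finite_G])
  show "W = carrier_vec (r * d)"
  proof (rule subspace_vec_UNIV[OF W])
    fix i assume i: "i < r * d"
    hence b: "i div d < r" by (simp add: less_mult_imp_div_less)
    have "unit_vec d (i mod d) \<in> ?V" unfolding V by simp
    hence "embed a (unit_vec d (i mod d)) \<in> W" by simp
    from unit_W[OF b e_in_G this] have "embed (i div d) (unit_vec d (i mod d)) \<in> W"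
      by (simp add: M_e project_embed a)
    moreover have "embed (i div d) (unit_vec d (i mod d)) = unit_vec (r * d) i"
    proof (rule eq_vecI)
      fix l assume "l < dim_vec (unit_vec (r * d) i)"
      moreover have "l div d = i div d \<and> l mod d = i mod d \<longleftrightarrow> l = i"
        by (metis div_mult_mod_eq)
      ultimately show "embed (i div d) (unit_vec d (i mod d)) $ l = unit_vec (r * d) i $ l"
        using dim_pos i by (auto simp: embed_def unit_vec_def)
    qed (simp add: embed_def)
    ultimately show "unit_vec (r * d) i \<in> W" by simp
  qed
qed (auto simp: fin N_mult)

end

text \<open>Comparing entries at the matrix units
  \<open>p 0 \<cdot> g \<cdot> (p 0)\<^sup>\<star>\<close> shows that the upper left block
  \<open>R\<close> of \<open>P\<close> intertwines the group representations. The same comparison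
  makes the rest of the first block row of \<open>P\<close> vanish, so \<open>R\<close> is nonzero
  because \<open>P\<close> is invertible.\<close>

lemma induced_equivalent_imp:
  assumes 1: "irreducible_representation G mul d1 \<rho>1" and 2: "irreducible_representation G mul d2 \<rho>2"
    and eq: "equivalent_representations S (r * d1, induced_representation d1 \<rho>1)
      (r * d2, induced_representation d2 \<rho>2)"
  shows "equivalent_representations G (d1, \<rho>1) (d2, \<rho>2)"
proof -
  obtain P Q where dd: "r * d2 = r * d1" and P: "P \<in> carrier_mat (r * d1) (r * d1)"
    and Q: "Q \<in> carrier_mat (r * d1) (r * d1)" and PQ: "P * Q = 1\<^sub>m (r * d1)"
    and int: "\<And>s. s \<in> S \<Longrightarrow> induced_representation d1 \<rho>1 (point_mass s) * P
      = P * induced_representation d2 \<rho>2 (point_mass s)"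
    using equivalent_intertwiner[OF fin irreducible_induced[OF 1] eq] by metis
  define d where "d = d1"
  have d: "d1 = d" "d2 = d" using dd r_pos by (simp_all add: d_def)
  have d0: "0 < d" using dim_pos[OF 1] by (simp add: d_def)
  let ?M1 = "\<lambda>g. \<rho>1 (point_mass g)" and ?M2 = "\<lambda>g. \<rho>2 (point_mass g)"
  note c1 = M_carrier[OF 1, unfolded d] and c2 = M_carrier[OF 2, unfolded d]
  note P = P[unfolded d] and Q = Q[unfolded d] and PQ = PQ[unfolded d]
  have "1 * d \<le> r * d" using r_pos by (intro mult_le_mono1) simp
  hence le: "i < r * d" if "i < d" for i using that by linarith
  have entries: "(\<Sum>l\<in>{0..<d}. ?M1 g $$ (i, l) * P $$ (l, j))
      = (if j < d then \<Sum>l\<in>{0..<d}. P $$ (i, l) * ?M2 g $$ (l, j) else 0)"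
    if g: "g \<in> G" and i: "i < d" and j: "j < r * d" for g i j
  proof -
    let ?s = "p 0 \<cdot> g \<cdot> (p 0)\<^sup>\<star>"
    have s: "?s \<in> S" using r_pos g by (simp add: G_in)
    have small: "l div d = 0 \<longleftrightarrow> l < d" for l using d0 by (simp add: div_eq_0_iff)
    have "(\<Sum>l\<in>{0..<d}. ?M1 g $$ (i, l) * P $$ (l, j))
        = (\<Sum>l\<in>{0..<r * d}. (if l < d then ?M1 g $$ (i mod d, l mod d) else 0) * P $$ (l, j))"
      using le r_pos i by (intro sum.mono_neutral_cong_left) auto
    also have "\<dots> = (induced d ?M1 ?s * P) $$ (i, j)"
      using i j P le[OF i] r_pos g small by (simp add: scalar_prod_def induced_unit_entry)
    also have "\<dots> = (P * induced d ?M2 ?s) $$ (i, j)"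
      using int[OF s] s by (simp add: induced_representation_point_mass d)
    also have "\<dots> = (\<Sum>l\<in>{0..<r * d}. P $$ (i, l) *
        (if l < d \<and> j < d then ?M2 g $$ (l mod d, j mod d) else 0))"
      using i j P le[OF i] r_pos g small by (simp add: scalar_prod_def induced_unit_entry)
    also have "\<dots> = (if j < d then \<Sum>l\<in>{0..<d}. P $$ (i, l) * ?M2 g $$ (l, j) else 0)"
      using le r_pos by (auto intro!: sum.mono_neutral_cong_right sum.neutral)
    finally show ?thesis .
  qed
  define R where "R = mat d d (\<lambda>(i, j). P $$ (i, j))"
  have "equivalent_representations G (d, \<rho>1) (d, \<rho>2)"
  proof (rule schur[OF finite_G 1[unfolded d] 2[unfolded d], of R])
    show "R \<in> carrier_mat d d" by (simp add: R_def)
    fix g assume g: "g \<in> G"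
    show "?M1 g * R = R * ?M2 g"
    proof (rule eq_matI)
      fix i j assume "i < dim_row (R * ?M2 g)" "j < dim_col (R * ?M2 g)"
      hence ij: "i < d" "j < d" using c2[OF g] by (auto simp: R_def)
      show "(?M1 g * R) $$ (i, j) = (R * ?M2 g) $$ (i, j)"
        using entries[OF g ij(1) le[OF ij(2)]] ij c1[OF g] c2[OF g]
        by (simp add: R_def scalar_prod_def)
    qed (use c1[OF g] c2[OF g] in \<open>auto simp: R_def\<close>)
  next
    show "R \<noteq> 0\<^sub>m d d"
    proof
      assume R: "R = 0\<^sub>m d d"
      have "P $$ (0, j) = 0" if j: "j < r * d" for j
      proof (cases "j < d")
        case True
        thus ?thesis using arg_cong[OF R, of "\<lambda>X. X $$ (0, j)"] d0 by (simp add: R_def)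
      next
        \<comment> \<open>Outside the first block column the right side of \<open>entries\<close> is
          zero, while for \<open>g = e\<close> its left side is the entry of \<open>P\<close>
          itself.\<close>
        case False
        have "P $$ (0, j) = (\<Sum>l\<in>{0..<d}. (1\<^sub>m d) $$ (0, l) * P $$ (l, j))"
        proof -
          have "(\<Sum>l\<in>{0..<d}. (1\<^sub>m d) $$ (0, l) * P $$ (l, j))
              = (\<Sum>l\<in>{0..<d}. if l = 0 then P $$ (l, j) else 0)"
            using d0 by (intro sum.cong) auto
          thus ?thesis using d0 by simp
        qed
        also have "\<dots> = 0" using entries[OF e_in_G d0 j] False M_e[OF 1] d by simp
        finally show ?thesis .
      qed
      hence "(P * Q) $$ (0, 0) = 0" using P Q d0 r_pos by (simp add: scalar_prod_def)
      thus False using PQ d0 r_pos by simp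
    qed
  qed
  thus ?thesis by (simp add: d)
qed

text \<open>The sum over \<open>t\<close> is sorted by the value \<open>h\<close> of its coordinate.
  The elements with value \<open>h\<close> are those above
  \<open>p a \<cdot> h \<cdot> (p b)\<^sup>\<star>\<close>, so each inner sum of \<open>f\<close> is
  one value of the zeta transform; elements without a coordinate in \<open>G\<close> contribute
  nothing.\<close>

lemma fourier_transform_induced:
  assumes ij: "i < r * d" "j < r * d"
  shows "fourier_transform S f (r * d, induced_representation d \<rho>) $$ (i, j) =
    fourier_transform G
      (\<lambda>h. zeta_transform S mul f (p (i div d) \<cdot> h \<cdot> (p (j div d))\<^sup>\<star>)) (d, \<rho>) $$ (i mod d, j mod d)"
proof -
  define a b where ab: "a = i div d" "b = j div d"
  have d: "0 < d" using ij by (cases d) auto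
  have [simp]: "a < r" "b < r" using ij by (auto simp: ab less_mult_imp_div_less)
  define m where "m h = \<rho> (point_mass h) $$ (i mod d, j mod d)" for h
  let ?T = "{t \<in> S. coord a b t \<in> G}"
  have "fourier_transform S f (r * d, induced_representation d \<rho>) $$ (i, j)
      = (\<Sum>t\<in>S. if coord a b t \<in> G then f t * m (coord a b t) else 0)"
    using ij by (auto simp: fourier_transform_def induced_representation_point_mass induced_entry
        m_def ab intro!: sum.cong)
  also have "\<dots> = (\<Sum>t\<in>?T. f t * m (coord a b t))"
    using fin by (intro sum.mono_neutral_cong_right) auto
  also have "\<dots> = (\<Sum>h\<in>G. \<Sum>t\<in>{t \<in> ?T. coord a b t = h}. f t * m (coord a b t))"
    using fin finite_G by (intro sum.group[symmetric]) auto
  also have "\<dots> = (\<Sum>h\<in>G. zeta_transform S mul f (p a \<cdot> h \<cdot> (p b)\<^sup>\<star>) * m h)"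
  proof (rule sum.cong)
    fix h assume h: "h \<in> G"
    have "{t \<in> ?T. coord a b t = h} = {t \<in> S. natural_le S mul (p a \<cdot> h \<cdot> (p b)\<^sup>\<star>) t}"
      using h by (auto simp: coord_eq_iff_natural_le)
    thus "(\<Sum>t\<in>{t \<in> ?T. coord a b t = h}. f t * m (coord a b t))
        = zeta_transform S mul f (p a \<cdot> h \<cdot> (p b)\<^sup>\<star>) * m h"
      using h by (auto simp: zeta_transform_def sum_distrib_right coord_eq_iff_natural_le
          intro!: sum.cong)
  qed simp
  finally show ?thesis using d by (simp add: fourier_transform_def m_def ab)
qed

lemma irreducible_equivalent_induced:
  assumes irr: "irreducible_representation S mul n \<sigma>"
    and e0: "\<sigma> (point_mass e) \<noteq> 0\<^sub>m n n"
    and minimal: "\<And>f. f \<in> E \<Longrightarrow> rank f < rank e \<Longrightarrow> \<sigma> (point_mass f) = 0\<^sub>m n n"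
    and Y: "complete_irreducibles G mul Y"
  shows "\<exists>(d, \<rho>)\<in>Y. equivalent_representations S (n, \<sigma>) (r * d, induced_representation d \<rho>)"
proof -
  define m where "m s = \<sigma> (point_mass s)" for s
  have m [simp]: "m s \<in> carrier_mat n n" if "s \<in> S" for s
    unfolding m_def by (rule irr_carrier[OF irr fin that])
  have mm: "m (s \<cdot> t) = m s * m t" if "s \<in> S" "t \<in> S" for s t
    unfolding m_def by (rule rep_point_mass_mult[OF irr_rep[OF irr fin] fin that])
  have mX: "m s * (m t * X) = m (s \<cdot> t) * X" if "s \<in> S" "t \<in> S" "X \<in> carrier_mat n k" for s t X k
    using that by (simp add: mm assoc_mult_mat[of _ n n _ n _ k])
  have mc [simp]: "m s * X \<in> carrier_mat n k" if "s \<in> S" "X \<in> carrier_mat n k" for s X k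
    using that by (intro mult_carrier_mat[of _ n n]) auto
  \<comment> \<open>The domain of \<open>x\<close> is a right factor of \<open>x\<close>, and
    minimality of \<open>e\<close> sends it to zero.\<close>
  have small: "m x = 0\<^sub>m n n" if "x \<in> S" "rank (x\<^sup>\<star> \<cdot> x) < rank e" for x
  proof -
    have "m x = m x * m (x\<^sup>\<star> \<cdot> x)" using that by (simp add: cancel flip: mm)
    moreover have "m (x\<^sup>\<star> \<cdot> x) = 0\<^sub>m n n"
      unfolding m_def using that by (intro minimal) (auto simp: dom_idem)
    ultimately show ?thesis using that by (simp add: right_mult_zero_mat[OF m])
  qed
  have "m e * m e = m e" by (simp flip: mm)
  then obtain d B C where B [simp]: "B \<in> carrier_mat n d" and C [simp]: "C \<in> carrier_mat d n"
    and BC: "B * C = m e" and CB: "C * B = 1\<^sub>m d"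
    by (rule idempotent_factorization[OF m[OF e_in]])
  note [simp] = carrier_matD[OF B] carrier_matD[OF C] carrier_matD[OF m] right_mult_one_mat[OF B] left_mult_one_mat[OF C] left_mult_one_mat[OF B]
  have eB: "m e * B = B" using CB by (simp add: BC[symmetric] assoc_mult_mat[of B n d C n B d])
  have Ce: "C * m e = C"
    using CB by (simp add: BC[symmetric] assoc_mult_mat[of C d n B d C n, symmetric] del: assoc_mult_mat)
  have d0: "0 < d"
  proof (rule ccontr)
    assume "\<not> 0 < d"
    hence "B * C = 0\<^sub>m n n" using B C by (intro eq_matI) (auto simp: scalar_prod_def)
    thus False using e0 BC by (simp add: m_def)
  qed
  \<comment> \<open>This is \<open>\<sigma>\<close> compressed to the image of
    \<open>\<sigma> e\<close>: \<open>B\<close> includes that image in coordinates and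
    \<open>C\<close> projects onto it along the kernel.\<close>
  define \<rho>0 where "\<rho>0 g = C * (m g * B)" for g
  have \<rho>0 [simp]: "\<rho>0 g \<in> carrier_mat d d" if "g \<in> G" for g
    using that by (simp add: \<rho>0_def G_in mult_carrier_mat[of _ d n] mult_carrier_mat[of _ n n])
  have B\<rho>0: "B * \<rho>0 g = m g * B" if g: "g \<in> G" for g
  proof -
    have "B * \<rho>0 g = (B * C) * (m g * B)"
      unfolding \<rho>0_def using G_in[OF g] by (intro assoc_mult_mat[symmetric, of _ n d _ n _ d]) auto
    thus ?thesis using g by (simp add: BC mX[of e g B d] G_in del: assoc_mult_mat)
  qed
  have irr0: "irreducible_representation G mul d (linear_extension G d \<rho>0)"
  proof (rule irreducible_linear_extension[OF finite_G])
    fix g h assume gh: "g \<in> G" "h \<in> G"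
    have "\<rho>0 g * \<rho>0 h = C * ((m g * B) * \<rho>0 h)"
      unfolding \<rho>0_def[of g] using gh
      by (intro assoc_mult_mat[of _ d n _ d _ d]) (auto simp: G_in)
    also have "(m g * B) * \<rho>0 h = m g * (B * \<rho>0 h)"
      using gh by (intro assoc_mult_mat[of _ n n _ d _ d]) (auto simp: G_in)
    also have "C * (m g * (B * \<rho>0 h)) = C * (m g * (m h * B))" using gh by (simp add: B\<rho>0)
    also have "\<dots> = \<rho>0 (g \<cdot> h)"
      using gh by (simp add: B\<rho>0 \<rho>0_def mX[of g h B d] G_in del: assoc_mult_mat)
    finally show "\<rho>0 (g \<cdot> h) = \<rho>0 g * \<rho>0 h" ..
  next
    have "\<rho>0 e = 1\<^sub>m d" by (simp add: \<rho>0_def eB CB)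
    moreover have "1\<^sub>m d \<noteq> (0\<^sub>m d d :: complex mat)"
      using d0 by (metis index_one_mat(1) index_zero_mat(1) zero_neq_one)
    ultimately show "\<rho>0 e \<noteq> 0\<^sub>m d d" by simp
  next
    fix W assume W: "subspace_vec d W" and st: "\<And>g w. g \<in> G \<Longrightarrow> w \<in> W \<Longrightarrow> \<rho>0 g *\<^sub>v w \<in> W"
      and W0: "W \<noteq> {0\<^sub>v d}"
    have Wc: "w \<in> carrier_vec d" if "w \<in> W" for w using W that by (auto simp: subspace_vec_iff)
    obtain w where w: "w \<in> W" "w \<noteq> 0\<^sub>v d" using W W0 by (auto simp: subspace_vec_iff)
    have ms [simp]: "m s *\<^sub>v u \<in> carrier_vec n" if "s \<in> S" "u \<in> carrier_vec n" for s u
      using that by (intro mult_mat_vec_carrier[OF m]) auto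
    \<comment> \<open>The largest submodule for \<open>S\<close> that \<open>C\<close> maps into \<open>W\<close>: it contains \<open>B w\<close>, so it is everything.\<close>
    let ?U = "{u \<in> carrier_vec n. \<forall>s\<in>S. C *\<^sub>v (m s *\<^sub>v u) \<in> W}"
    have "subspace_vec n ?U"
      unfolding subspace_vec_iff
    proof (intro conjI ballI allI)
      have "C *\<^sub>v (m s *\<^sub>v 0\<^sub>v n) = 0\<^sub>v d" if "s \<in> S" for s
      proof -
        show ?thesis using that by (simp add: mult_mat_zero_vec[OF m] mult_mat_zero_vec[OF C])
      qed
      thus "0\<^sub>v n \<in> ?U" using W by (simp add: subspace_vec_iff)
    next
      fix u v assume uv: "u \<in> ?U" "v \<in> ?U"
      hence "C *\<^sub>v (m s *\<^sub>v (u + v)) = C *\<^sub>v (m s *\<^sub>v u) + C *\<^sub>v (m s *\<^sub>v v)" if "s \<in> S" for s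
        using that by (simp add: mult_add_distrib_mat_vec[of _ n n] mult_add_distrib_mat_vec[of _ d n])
      thus "u + v \<in> ?U" using uv W by (simp add: subspace_vec_iff)
    next
      fix c u assume u: "u \<in> ?U"
      hence "C *\<^sub>v (m s *\<^sub>v (c \<cdot>\<^sub>v u)) = c \<cdot>\<^sub>v (C *\<^sub>v (m s *\<^sub>v u))" if "s \<in> S" for s
        using that by (simp add: mult_mat_vec[of _ n n] mult_mat_vec[of _ d n])
      thus "c \<cdot>\<^sub>v u \<in> ?U" using u W by (simp add: subspace_vec_iff)
    qed auto
    moreover have "\<sigma> (point_mass t) *\<^sub>v u \<in> ?U" if "t \<in> S" "u \<in> ?U" for t u
    proof -
      have "m s *\<^sub>v (m t *\<^sub>v u) = m (s \<cdot> t) *\<^sub>v u" if "s \<in> S" for s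
        using that \<open>t \<in> S\<close> \<open>u \<in> ?U\<close> by (simp add: mm assoc_mult_mat_vec[of _ n n _ n])
      hence "m t *\<^sub>v u \<in> ?U" using that by simp
      thus ?thesis by (simp add: m_def)
    qed
    moreover have BU: "B *\<^sub>v v \<in> ?U" if v: "v \<in> W" for v
    proof -
      have "C *\<^sub>v (m s *\<^sub>v (B *\<^sub>v v)) \<in> W" if s: "s \<in> S" for s
      proof -
        \<comment> \<open>Since \<open>C\<close> absorbs \<open>m e\<close> on the right and
          \<open>B\<close> on the left, \<open>s\<close> may be replaced by its corner at
          \<open>e\<close>. The corner either lies in \<open>G\<close>, under which \<open>W\<close>
          is stable, or acts as zero by \<open>rank_corner\<close>.\<close>
        let ?t = "e \<cdot> (s \<cdot> e)"
        have "C * (m s * B) = (C * m e) * (m s * (m e * B))" by (simp add: Ce eB)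
        also have "\<dots> = C * (m ?t * B)"
          using s by (simp add: mX[of s e B d] mX[of e "s \<cdot> e" B d] mult_carrier_mat[of _ n n]
              assoc_mult_mat[of C d n "m e" n "m (s \<cdot> e) * B" d] del: assoc_mult_mat)
        finally have "C *\<^sub>v (m s *\<^sub>v (B *\<^sub>v v)) = (C * (m ?t * B)) *\<^sub>v v"
          using Wc[OF v] s m[OF s]
          by (simp add: assoc_mult_mat_vec[of B n d, symmetric] assoc_mult_mat_vec[of _ n n _ d, symmetric]
              assoc_mult_mat_vec[of _ d n _ d, symmetric] mult_carrier_mat[of _ n n] del: assoc_mult_mat)
        moreover have "(C * (m ?t * B)) *\<^sub>v v \<in> W"
        proof (cases "?t \<in> G")
          case True
          thus ?thesis using st[OF True v] by (simp add: \<rho>0_def)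
        next
          case False
          hence "m ?t = 0\<^sub>m n n" using s rank_corner[OF s False] by (intro small) auto
          hence "(C * (m ?t * B)) *\<^sub>v v = 0\<^sub>v d" using Wc[OF v]
            by (simp add: left_mult_zero_mat[OF B] right_mult_zero_mat[OF C] zero_mult_mat_vec)
          thus ?thesis using W by (simp add: subspace_vec_iff)
        qed
        ultimately show ?thesis by simp
      qed
      moreover have "B *\<^sub>v v \<in> carrier_vec n" using B Wc[OF v] by (rule mult_mat_vec_carrier)
      ultimately show ?thesis by simp
    qed
    moreover have "?U \<noteq> {0\<^sub>v n}"
    proof
      assume "?U = {0\<^sub>v n}"
      hence "B *\<^sub>v w = 0\<^sub>v n" using BU[OF w(1)] by blast
      moreover have "C *\<^sub>v (B *\<^sub>v w) = w"
        using Wc[OF w(1)] by (simp add: assoc_mult_mat_vec[OF C B, symmetric] CB)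
      ultimately show False using w(2) by (simp add: mult_mat_zero_vec[OF C])
    qed
    ultimately have U: "?U = carrier_vec n" by (intro irr_subspace[OF irr fin]) blast+
    show "W = carrier_vec d"
    proof
      show "carrier_vec d \<subseteq> W"
      proof
        fix c :: "complex vec" assume c: "c \<in> carrier_vec d"
        have "B *\<^sub>v c \<in> ?U" unfolding U using B c by (rule mult_mat_vec_carrier)
        hence "C *\<^sub>v (m e *\<^sub>v (B *\<^sub>v c)) \<in> W" by simp
        moreover have "C *\<^sub>v (m e *\<^sub>v (B *\<^sub>v c)) = c"
          using c by (simp add: assoc_mult_mat_vec[OF m B, symmetric] eB
              assoc_mult_mat_vec[OF C B, symmetric] CB)
        ultimately show "c \<in> W" by simp
      qed
    qed (use W in \<open>simp add: subspace_vec_iff\<close>)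
  qed auto
  obtain d' \<rho> where dY: "(d', \<rho>) \<in> Y"
    and eq: "equivalent_representations G (d, linear_extension G d \<rho>0) (d', \<rho>)"
    using Y irr0 unfolding complete_irreducibles_def by fast
  have irr\<rho>: "irreducible_representation G mul d' \<rho>"
    using Y dY unfolding complete_irreducibles_def by auto
  obtain P Q where dd: "d' = d" and P: "P \<in> carrier_mat d d" and Q: "Q \<in> carrier_mat d d"
    and PQ: "P * Q = 1\<^sub>m d"
    and int: "\<And>g. g \<in> G \<Longrightarrow> linear_extension G d \<rho>0 (point_mass g) * P = P * \<rho> (point_mass g)"
    using equivalent_intertwiner[OF finite_G irr0 eq] by metis
  \<comment> \<open>Another basis of the image of \<open>\<sigma> e\<close>, adapted so that
    \<open>g\<close> acts in it by the matrix of the chosen member of \<open>Y\<close> instead of an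
    equivalent one.\<close>
  define V where "V = B * P"
  have V [simp]: "V \<in> carrier_mat n d" unfolding V_def using B P by (rule mult_carrier_mat)
  note [simp] = carrier_matD[OF V]
  have mV: "m g * V = V * \<rho> (point_mass g)" if g: "g \<in> G" for g
  proof -
    have gS [simp]: "g \<in> S" using g by (rule G_in)
    have \<rho>c: "\<rho> (point_mass g) \<in> carrier_mat d d" using irr_carrier[OF irr\<rho> finite_G g] dd by simp
    have "m g * V = (m g * B) * P"
      unfolding V_def using P by (intro assoc_mult_mat[symmetric, of _ n n _ d _ d]) auto
    also have "\<dots> = (B * \<rho>0 g) * P" by (simp add: B\<rho>0 g)
    also have "\<dots> = B * (\<rho>0 g * P)" using P g by (intro assoc_mult_mat[of _ n d _ d _ d]) auto
    also have "\<rho>0 g * P = P * \<rho> (point_mass g)"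
      using int[OF g] g by (simp add: linear_extension_point_mass finite_G)
    also have "B * (P * \<rho> (point_mass g)) = V * \<rho> (point_mass g)"
      unfolding V_def using P \<rho>c by (intro assoc_mult_mat[symmetric, of _ n d _ d _ d]) auto
    finally show ?thesis .
  qed
  \<comment> \<open>Column block \<open>a\<close> is the basis \<open>V\<close> moved by
    \<open>p a\<close>. So \<open>T\<close> maps copy \<open>a\<close> of the induced space into the
    image of the range idempotent of \<open>p a\<close>.\<close>
  define T where "T = mat n (r * d) (\<lambda>(x, l). (m (p (l div d)) * V) $$ (x, l mod d))"
  have pV [simp]: "m s * V \<in> carrier_mat n d" if "s \<in> S" for s
    using that by (intro mult_carrier_mat[of _ n n]) auto
  have "equivalent_representations S (n, \<sigma>) (r * d, induced_representation d \<rho>)"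
  proof (rule schur[OF fin irr irreducible_induced[OF irr\<rho>, unfolded dd], of T])
    show "T \<in> carrier_mat n (r * d)" by (simp add: T_def)
    show "T \<noteq> 0\<^sub>m n (r * d)"
    proof
      assume T0: "T = 0\<^sub>m n (r * d)"
      have "m (p 0) * V = 0\<^sub>m n d"
      proof (rule eq_matI)
        fix x l assume "x < dim_row (0\<^sub>m n d)" "l < dim_col (0\<^sub>m n d)"
        hence xl: "x < n" "l < d" by simp_all
        have "1 * d \<le> r * d" using r_pos by (intro mult_le_mono1) simp
        hence "l < r * d" using xl by linarith
        thus "(m (p 0) * V) $$ (x, l) = 0\<^sub>m n d $$ (x, l)"
          using arg_cong[OF T0, of "\<lambda>X. X $$ (x, l)"] xl by (simp add: T_def)
      qed (use pV[of "p 0"] r_pos in auto)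
      \<comment> \<open>The inverse of \<open>p 0\<close> brings back \<open>m e * V\<close>, which
        is \<open>B * P\<close>; this cannot vanish, since \<open>C\<close> and \<open>Q\<close>
        reduce it to the identity.\<close>
      hence "m ((p 0)\<^sup>\<star>) * (m (p 0) * V) = 0\<^sub>m n d"
        using r_pos by (simp add: right_mult_zero_mat[OF m])
      hence "m e * V = 0\<^sub>m n d" using r_pos by (simp add: mX[of _ _ V d] p_dom del: assoc_mult_mat)
      moreover have "m e * V = (m e * B) * P"
        unfolding V_def using P by (intro assoc_mult_mat[symmetric, of _ n n _ d _ d]) auto
      ultimately have z: "B * P = 0\<^sub>m n d" by (simp add: eB)
      have "1\<^sub>m d = C * B * (P * Q)" by (simp add: CB PQ)
      also have "\<dots> = C * ((B * P) * Q)"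
        using mult_carrier_mat[OF P Q] by (simp add: assoc_mult_mat[OF B P Q] assoc_mult_mat[OF C B])
      also have "\<dots> = 0\<^sub>m d d" unfolding z using Q C by (simp add: left_mult_zero_mat[OF Q] right_mult_zero_mat[OF C])
      finally have o: "1\<^sub>m d = (0\<^sub>m d d :: complex mat)" .
      have "(1\<^sub>m d :: complex mat) $$ (0, 0) = 0" unfolding o using d0 by simp
      thus False using d0 by simp
    qed
    fix s assume s: "s \<in> S"
    have "m s * T = T * induced d (\<lambda>g. \<rho> (point_mass g)) s"
    proof (rule eq_matI)
      fix x l assume "x < dim_row (T * induced d (\<lambda>g. \<rho> (point_mass g)) s)"
        "l < dim_col (T * induced d (\<lambda>g. \<rho> (point_mass g)) s)"
      hence xl: "x < n" "l < r * d" by (simp_all add: T_def)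
      define b j where bj: "b = l div d" "j = l mod d"
      have b: "b < r" "j < d" using xl d0 by (auto simp: bj less_mult_imp_div_less)
      define X where "X a i = (m (p a) * V) $$ (x, i)" for a i
      define Z where "Z a i = (if coord a b s \<in> G then \<rho> (point_mass (coord a b s)) $$ (i, j) else 0)" for a i
      have L: "(m s * T) $$ (x, l) = (m (s \<cdot> p b) * V) $$ (x, j)"
      proof -
        have "(m s * T) $$ (x, l) = (\<Sum>y\<in>{0..<n}. m s $$ (x, y) * (m (p b) * V) $$ (y, j))"
          using xl m[OF s] by (simp add: scalar_prod_def T_def bj)
        also have "\<dots> = (m s * (m (p b) * V)) $$ (x, j)"
          by (subst index_mult_mat(1)) (use xl s b in \<open>auto simp: scalar_prod_def carrier_matD[OF V]\<close>)
        finally show ?thesis using b s by (simp add: mX[of s "p b" V d] del: assoc_mult_mat index_mult_mat)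
      qed
      have "(T * induced d (\<lambda>g. \<rho> (point_mass g)) s) $$ (x, l)
          = (\<Sum>k\<in>{0..<r * d}. X (k div d) (k mod d) * Z (k div d) (k mod d))"
        using xl unfolding X_def Z_def bj by (simp add: scalar_prod_def T_def induced_entry)
      also have "\<dots> = (\<Sum>a\<in>{0..<r}. \<Sum>i\<in>{0..<d}. X a i * Z a i)"
        by (rule sum_div_mod[OF d0, of "\<lambda>a i. X a i * Z a i"])
      also have "\<dots> = (m (s \<cdot> p b) * V) $$ (x, j)"
      proof (cases "\<exists>a<r. coord a b s \<in> G")
        case True
        then obtain a where a: "a < r" "coord a b s \<in> G" by blast
        let ?g = "coord a b s"
        have g [simp]: "?g \<in> S" using a by (simp add: G_in)
        have Z0: "Z a' i = 0" if "a' < r" "a' \<noteq> a" for a' i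
          using coord_unique[of a' a b s] that a b s by (auto simp: Z_def)
        have \<rho>c: "\<rho> (point_mass ?g) \<in> carrier_mat d d" using irr_carrier[OF irr\<rho> finite_G a(2)] dd by simp
        have "(\<Sum>a\<in>{0..<r}. \<Sum>i\<in>{0..<d}. X a i * Z a i) = (\<Sum>a\<in>{a}. \<Sum>i\<in>{0..<d}. X a i * Z a i)"
          using a Z0 by (intro sum.mono_neutral_right) auto
        also have "\<dots> = ((m (p a) * V) * \<rho> (point_mass ?g)) $$ (x, j)"
          using a b xl \<rho>c pV[of "p a"] by (subst index_mult_mat(1)) (auto simp: X_def Z_def scalar_prod_def)
        also have "(m (p a) * V) * \<rho> (point_mass ?g) = m (p a) * (V * \<rho> (point_mass ?g))"
          using a \<rho>c by (intro assoc_mult_mat[of _ n n _ d _ d]) auto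
        also have "\<dots> = m (p a) * (m ?g * V)" by (simp add: mV a)
        also have "\<dots> = m (p a \<cdot> ?g) * V" using a by (intro mX[of _ _ V d]) auto
        also have "p a \<cdot> ?g = s \<cdot> p b" using mul_p_eq[of a b s] a b s by simp
        finally show ?thesis .
      next
        case False
        \<comment> \<open>Without a group coordinate the induced matrix has only zero blocks in
          column \<open>b\<close>. On the other side the domain of \<open>s \<cdot> p b\<close> has
          rank below that of \<open>e\<close>, so minimality gives zero as well.\<close>
        hence "\<not> based (s \<cdot> p b)" using based_coord[of b s] b s by blast
        hence "m (s \<cdot> p b) = 0\<^sub>m n n"
          using b s by (intro small rank_not_based mul_p_e) auto
        hence "(m (s \<cdot> p b) * V) $$ (x, j) = 0" using xl b by (simp add: left_mult_zero_mat[OF V])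
        thus ?thesis using False by (simp add: Z_def)
      qed
      finally show "(m s * T) $$ (x, l) = (T * induced d (\<lambda>g. \<rho> (point_mass g)) s) $$ (x, l)"
        using L by simp
    qed (use m[OF s] in \<open>auto simp: T_def\<close>)
    thus "\<sigma> (point_mass s) * T = T * induced_representation d \<rho> (point_mass s)"
      using s by (simp add: induced_representation_point_mass m_def)
  qed
  thus ?thesis using dY dd by auto
qed

end

text \<open>Each induced representation is nonzero at its own idempotent, so by equivalence the
  other one is nonzero there too. \<open>coord_idem\<close> turns this into inequalities between the
  ranks in both directions, and equal ranks give the isomorphism.\<close>

lemma induced_equivalent_isomorphic:
  assumes 1: "d_class S mul e1 r1 p1" and 2: "d_class S mul e2 r2 p2"
    and irr1: "irreducible_representation (maximal_subgroup S mul e1) mul d1 \<rho>1"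
    and irr2: "irreducible_representation (maximal_subgroup S mul e2) mul d2 \<rho>2"
    and eq: "equivalent_representations S
      (r1 * d1, d_class.induced_representation S mul e1 r1 p1 d1 \<rho>1)
      (r2 * d2, d_class.induced_representation S mul e2 r2 p2 d2 \<rho>2)"
  shows "isomorphic_idempotents S mul e1 e2"
proof -
  interpret A: d_class S mul e1 r1 p1 by (rule 1)
  interpret B: d_class S mul e2 r2 p2 by (rule 2)
  define n where "n = r1 * d1"
  let ?N1 = "A.induced d1 (\<lambda>g. \<rho>1 (point_mass g))" and ?N2 = "B.induced d2 (\<lambda>g. \<rho>2 (point_mass g))"
  obtain P Q where n: "r2 * d2 = n" and P: "P \<in> carrier_mat n n" and Q: "Q \<in> carrier_mat n n"
    and PQ: "P * Q = 1\<^sub>m n" "Q * P = 1\<^sub>m n"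
    and int: "\<And>s. s \<in> S \<Longrightarrow> A.induced_representation d1 \<rho>1 (point_mass s) * P
      = P * B.induced_representation d2 \<rho>2 (point_mass s)"
    using equivalent_intertwiner[OF A.fin A.irreducible_induced[OF irr1] eq] unfolding n_def by metis
  have N: "?N1 s \<in> carrier_mat n n" "?N2 s \<in> carrier_mat n n" for s
    by (simp add: n_def) (unfold n[symmetric], rule B.induced_carrier)
  have int': "?N1 s * P = P * ?N2 s" if "s \<in> S" for s
    using int[OF that] that
    by (simp add: A.induced_representation_point_mass B.induced_representation_point_mass)
  have "?N2 e1 \<noteq> 0\<^sub>m n n"
  proof
    assume z: "?N2 e1 = 0\<^sub>m n n"
    have "?N1 e1 = ?N1 e1 * P * Q"
      by (simp add: assoc_mult_mat[OF N(1) P Q] PQ right_mult_one_mat[OF N(1)])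
    also have "\<dots> = 0\<^sub>m n n" using int'[of e1] z P Q by simp
    finally show False using A.N_e_nonzero[OF irr1] by (simp add: n_def)
  qed
  hence "\<exists>i<r2. \<exists>j<r2. B.coord i j e1 \<in> maximal_subgroup S mul e2"
    by (intro B.induced_nonzero[of d2 "\<lambda>g. \<rho>2 (point_mass g)"]) (simp add: n)
  then obtain i j where ij: "i < r2" "j < r2" "B.coord i j e1 \<in> maximal_subgroup S mul e2"
    by blast
  have "?N1 e2 \<noteq> 0\<^sub>m n n"
  proof
    assume z: "?N1 e2 = 0\<^sub>m n n"
    have "?N2 e2 = Q * (P * ?N2 e2)"
      using N[of e2] P Q PQ by (simp add: assoc_mult_mat[of Q n n P n "?N2 e2" n, symmetric] left_mult_one_mat[OF N(2)]
          del: assoc_mult_mat)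
    also have "\<dots> = 0\<^sub>m n n" using int'[of e2] z P Q by (simp flip: int')
    finally show False using B.N_e_nonzero[OF irr2] n by simp
  qed
  hence "\<exists>i<r1. \<exists>j<r1. A.coord i j e2 \<in> maximal_subgroup S mul e1"
    by (intro A.induced_nonzero[of d1 "\<lambda>g. \<rho>1 (point_mass g)"]) (simp add: n_def)
  then obtain i' j' where ij': "i' < r1" "j' < r1" "A.coord i' j' e2 \<in> maximal_subgroup S mul e1"
    by blast
  show ?thesis
    using A.coord_idem[OF ij'(1,2) B.e_idem ij'(3)] B.coord_idem(1)[OF ij(1,2) A.e_idem ij(3)] by blast
qed

section \<open>Choice of a minimal idempotent and of coordinates\<close>

context inverse_semigroup
begin

lemma iso_idem_rank:
  assumes "finite S" "isomorphic_idempotents S mul a b"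
  shows "rank a = rank b"
  using assms rank_ran[OF assms(1)] unfolding isomorphic_idempotents_def by auto

text \<open>An idempotent of least rank with nonzero image has the property. It passes to every
  isomorphic \<open>b\<close>, since conjugation recovers \<open>a\<close> from \<open>b\<close> and
  ranks agree. This generality is needed because the representative of each D-class is
  prescribed.\<close>

lemma irreducible_minimal_idempotent:
  assumes fin: "finite S" and irr: "irreducible_representation S mul n \<sigma>"
  shows "\<exists>a\<in>E. \<forall>b. isomorphic_idempotents S mul a b \<longrightarrow> \<sigma> (point_mass b) \<noteq> 0\<^sub>m n n \<and>
    (\<forall>f\<in>E. rank f < rank b \<longrightarrow> \<sigma> (point_mass f) = 0\<^sub>m n n)"
proof -
  define m where "m s = \<sigma> (point_mass s)" for s
  have m: "m s \<in> carrier_mat n n" if "s \<in> S" for s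
    unfolding m_def by (rule irr_carrier[OF irr fin that])
  have mm: "m (s \<cdot> t) = m s * m t" if "s \<in> S" "t \<in> S" for s t
    unfolding m_def by (rule rep_point_mass_mult[OF irr_rep[OF irr fin] fin that])
  obtain s where s: "s \<in> S" "m s \<noteq> 0\<^sub>m n n"
    using irr_point_mass_nonzero[OF irr fin] by (auto simp: m_def)
  have "m s = m s * m (s\<^sup>\<star> \<cdot> s)" using s by (simp add: cancel flip: mm)
  hence "m (s\<^sup>\<star> \<cdot> s) \<noteq> 0\<^sub>m n n" using s m[OF s(1)] by auto
  hence "\<exists>a. a \<in> E \<and> m a \<noteq> 0\<^sub>m n n" using s dom_idem by blast
  then obtain a0 where "a0 \<in> E \<and> m a0 \<noteq> 0\<^sub>m n n" by blast
  from ex_has_least_nat[of "\<lambda>a. a \<in> E \<and> m a \<noteq> 0\<^sub>m n n", OF this, of rank]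
  obtain a where a: "a \<in> E" "m a \<noteq> 0\<^sub>m n n"
    and least: "\<And>f. f \<in> E \<Longrightarrow> m f \<noteq> 0\<^sub>m n n \<Longrightarrow> rank a \<le> rank f" by blast
  have "m b \<noteq> 0\<^sub>m n n \<and> (\<forall>f\<in>E. rank f < rank b \<longrightarrow> m f = 0\<^sub>m n n)"
    if iso: "isomorphic_idempotents S mul a b" for b
  proof
    obtain x where x: "x \<in> S" and ax: "a = x\<^sup>\<star> \<cdot> x" and bx: "b = x \<cdot> x\<^sup>\<star>"
      using iso unfolding isomorphic_idempotents_def by blast
    have "a = x\<^sup>\<star> \<cdot> b \<cdot> x" using x by (simp add: ax bx assoc cancel)
    hence "m a = m (x\<^sup>\<star> \<cdot> b \<cdot> x)" by simp
    also have "\<dots> = m (x\<^sup>\<star>) * m b * m x" using x by (simp add: mm bx del: assoc_mult_mat)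
    finally have "m a = m (x\<^sup>\<star>) * m b * m x" .
    moreover have "m (x\<^sup>\<star>) * 0\<^sub>m n n * m x = 0\<^sub>m n n"
      using x m[of "x\<^sup>\<star>"] m[of x] by simp
    ultimately show "m b \<noteq> 0\<^sub>m n n" using a(2) by metis
    show "\<forall>f\<in>E. rank f < rank b \<longrightarrow> m f = 0\<^sub>m n n"
      using least iso_idem_rank[OF fin iso] by fastforce
  qed
  thus ?thesis using a(1) unfolding m_def by blast
qed

lemma d_class_exists:
  assumes fin: "finite S" and e: "e \<in> E"
  shows "\<exists>p. d_class S mul e (card {a. isomorphic_idempotents S mul e a}) p"
proof -
  let ?A = "{a. isomorphic_idempotents S mul e a}"
  have "finite ?A" using fin_idem[OF fin]
    by (rule rev_finite_subset) (auto simp: isomorphic_idempotents_def)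
  then obtain h where h: "bij_betw h {0..<card ?A} ?A" using ex_bij_betw_nat_finite by blast
  have "\<forall>i. \<exists>s. i < card ?A \<longrightarrow> s \<in> S \<and> s\<^sup>\<star> \<cdot> s = e \<and> s \<cdot> s\<^sup>\<star> = h i"
  proof
    fix i
    have "isomorphic_idempotents S mul e (h i)" if "i < card ?A"
      using bij_betw_apply[OF h, of i] that by simp
    thus "\<exists>s. i < card ?A \<longrightarrow> s \<in> S \<and> s\<^sup>\<star> \<cdot> s = e \<and> s \<cdot> s\<^sup>\<star> = h i"
      unfolding isomorphic_idempotents_def by metis
  qed
  from choice[OF this] obtain p where p: "\<And>i. i < card ?A \<Longrightarrow> p i \<in> S"
    "\<And>i. i < card ?A \<Longrightarrow> (p i)\<^sup>\<star> \<cdot> p i = e" "\<And>i. i < card ?A \<Longrightarrow> p i \<cdot> (p i)\<^sup>\<star> = h i" by blast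
  have "d_class S mul e (card ?A) p"
  proof
    fix i j assume "i < card ?A" "j < card ?A" "p i \<cdot> (p i)\<^sup>\<star> = p j \<cdot> (p j)\<^sup>\<star>"
    thus "i = j" using p(3) bij_betw_imp_inj_on[OF h] by (auto simp: inj_on_def)
  next
    fix x assume x: "x \<in> S" "x\<^sup>\<star> \<cdot> x = e"
    hence "x \<cdot> x\<^sup>\<star> \<in> ?A" using iso_idem_ran by blast
    hence "x \<cdot> x\<^sup>\<star> \<in> h ` {0..<card ?A}" by (simp only: bij_betw_imp_surj_on[OF h])
    then obtain i where "i \<in> {0..<card ?A}" and hi: "x \<cdot> x\<^sup>\<star> = h i" by blast
    hence i: "i < card ?A" by (simp only: atLeastLessThan_iff)
    show "\<exists>i<card ?A. x \<cdot> x\<^sup>\<star> = p i \<cdot> (p i)\<^sup>\<star>"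
      by (rule exI[of _ i], rule conjI[OF i]) (simp only: hi p(3)[OF i])
  qed (simp_all add: p(1,2) fin e)
  thus ?thesis by blast
qed

end

section \<open>The bound\<close>

theorem theorem4p9:
  fixes S :: "'a set" and mul :: "'a \<Rightarrow> 'a \<Rightarrow> 'a"
    and n :: nat and D :: "nat \<Rightarrow> 'a set" and r :: "nat \<Rightarrow> nat"
    and e :: "nat \<Rightarrow> 'a" and G :: "nat \<Rightarrow> 'a set"
  assumes "inverse_semigroup S mul" and "finite S"
    and "bij_betw D {0..n} (D_classes S mul)"
    and "\<And>k. k \<le> n \<Longrightarrow> r k = card (idempotents S mul \<inter> D k)"
    and "\<And>k. k \<le> n \<Longrightarrow> e k \<in> idempotents S mul \<inter> D k"
    and "\<And>k. k \<le> n \<Longrightarrow> G k = maximal_subgroup S mul (e k)"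
  shows "fourier_complexity S mul
    \<le> zeta_complexity S mul + (\<Sum>k=0..n. enat ((r k)\<^sup>2) * fourier_complexity (G k) mul)"
proof -
  interpret inverse_semigroup S mul by (rule assms(1))
  note fin = assms(2)
  have eE: "e k \<in> idempotents S mul" if "k \<le> n" for k using assms(5)[OF that] by simp
  have Dk: "D k = green_D S mul `` {e k}" if "k \<le> n" for k
  proof -
    have "D k \<in> S // green_D S mul"
      using bij_betw_apply[OF assms(3), of k] that by (simp add: D_classes_def)
    then obtain x where x: "D k = green_D S mul `` {x}" by (rule quotientE)
    have "e k \<in> green_D S mul `` {x}" using assms(5)[OF that] x by simp
    thus ?thesis using equiv_class_eq[OF green_equiv] x by simp
  qed
  have r: "r k = card {a. isomorphic_idempotents S mul (e k) a}" if k: "k \<le> n" for k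
  proof -
    have "idempotents S mul \<inter> D k = {a. isomorphic_idempotents S mul (e k) a}"
      using green_idem_iff[OF eE[OF k]] by (auto simp: Dk[OF k]) (auto simp: isomorphic_idempotents_def)
    thus ?thesis using assms(4)[OF k] by simp
  qed
  have "\<forall>k. \<exists>p. k \<le> n \<longrightarrow> d_class S mul (e k) (r k) p"
    using d_class_exists[OF fin eE] r by metis
  from choice[OF this] obtain p where p: "\<And>k. k \<le> n \<Longrightarrow> d_class S mul (e k) (r k) (p k)"
    by blast
  have r_pos: "0 < r k" if "k \<le> n" for k by (rule d_class.r_pos[OF p[OF that]])
  have iso_eq: "k = k'" if "k \<le> n" "k' \<le> n" "isomorphic_idempotents S mul (e k) (e k')" for k k'
  proof -
    have "(e k, e k') \<in> green_D S mul" using that eE by (simp add: green_idem_iff)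
    hence "D k = D k'" using that equiv_class_eq[OF green_equiv] by (simp add: Dk)
    thus ?thesis using bij_betw_imp_inj_on[OF assms(3)] that by (auto simp: inj_on_def)
  qed

  show ?thesis
  \<comment> \<open>A finite right-hand side means that the minima in it are attained, which
    supplies the programs to be composed.\<close>
  proof (cases "zeta_complexity S mul + (\<Sum>k=0..n. enat ((r k)\<^sup>2) * fourier_complexity (G k) mul) = \<infinity>")
    case True
    show ?thesis unfolding True by simp
  next
    case False
    hence zeta: "zeta_complexity S mul \<noteq> \<infinity>"
      and sum: "(\<Sum>k=0..n. enat ((r k)\<^sup>2) * fourier_complexity (G k) mul) \<noteq> \<infinity>"
      by (auto simp: plus_eq_infty_iff_enat simp del: not_infinity_eq)
    define optimal where "optimal k = (\<lambda>(Y, Q). complete_irreducibles (G k) mul Y \<and>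
        computes (G k) {(y, i, j). y \<in> Y \<and> i < fst y \<and> j < fst y}
          (\<lambda>f (y, i, j). fourier_transform (G k) f y $$ (i, j)) Q \<and>
        fourier_complexity (G k) mul = enat (length Q))" for k
    have "\<exists>YQ. optimal k YQ" if k: "k \<le> n" for k
    proof -
      have "enat ((r k)\<^sup>2) * fourier_complexity (G k) mul \<noteq> \<infinity>"
      proof
        assume i: "enat ((r k)\<^sup>2) * fourier_complexity (G k) mul = \<infinity>"
        have "enat ((r k)\<^sup>2) * fourier_complexity (G k) mul
            \<le> (\<Sum>k=0..n. enat ((r k)\<^sup>2) * fourier_complexity (G k) mul)"
          using k by (intro member_le_sum) auto
        thus False using sum unfolding i by simp
      qed
      \<comment> \<open>In the extended naturals \<open>0 * \<infinity> = 0\<close>, so positivity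
        of \<open>r k\<close> is what makes the factor finite.\<close>
      hence fin_k: "fourier_complexity (G k) mul \<noteq> \<infinity>"
        using r_pos[OF k] by (auto simp: zero_enat_def imult_is_infinity)
      from Inf_enat_attained[OF this[unfolded fourier_complexity_def]]
      obtain Y where Y: "complete_irreducibles (G k) mul Y"
        and eq: "fourier_complexity (G k) mul = fourier_complexity_wrt (G k) Y"
        by (auto simp flip: fourier_complexity_def)
      obtain Q where "computes (G k) {(y, i, j). y \<in> Y \<and> i < fst y \<and> j < fst y}
          (\<lambda>f (y, i, j). fourier_transform (G k) f y $$ (i, j)) Q"
        "fourier_complexity_wrt (G k) Y = enat (length Q)"
        using operation_count_attained[OF fin_k[unfolded eq fourier_complexity_wrt_def]]
        unfolding fourier_complexity_wrt_def by blast
      hence "optimal k (Y, Q)" using Y eq by (simp add: optimal_def)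
      thus ?thesis ..
    qed
    hence "\<forall>k. \<exists>YQ. k \<le> n \<longrightarrow> optimal k YQ" by blast
    from choice[OF this] obtain YQ where YQ: "\<And>k. k \<le> n \<Longrightarrow> optimal k (YQ k)" by blast
    define Y Q where "Y k = fst (YQ k)" and "Q k = snd (YQ k)" for k
    have "optimal k (Y k, Q k)" if "k \<le> n" for k using YQ[OF that] by (simp add: Y_def Q_def)
    hence Y: "\<And>k. k \<le> n \<Longrightarrow> complete_irreducibles (G k) mul (Y k)"
      and Q: "\<And>k. k \<le> n \<Longrightarrow> computes (G k) {(y, i, j). y \<in> Y k \<and> i < fst y \<and> j < fst y}
          (\<lambda>f (y, i, j). fourier_transform (G k) f y $$ (i, j)) (Q k)"
      and len: "\<And>k. k \<le> n \<Longrightarrow> fourier_complexity (G k) mul = enat (length (Q k))"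
      unfolding optimal_def by blast+
    obtain P where P: "computes S S (zeta_transform S mul) P"
      and lenP: "zeta_complexity S mul = enat (length P)"
      using operation_count_attained[OF zeta[unfolded zeta_complexity_def]]
      unfolding zeta_complexity_def by metis

    define ind where "ind k y = (r k * fst y,
      d_class.induced_representation S mul (e k) (r k) (p k) (fst y) (snd y))" for k and y :: "nat \<times> (('a \<Rightarrow> complex) \<Rightarrow> complex mat)"
    define Z where "Z = (\<Union>k\<in>{0..n}. ind k ` Y k)"
    have irrY: "irreducible_representation (maximal_subgroup S mul (e k)) mul (fst y) (snd y)"
      if "k \<le> n" "y \<in> Y k" for k y
      using Y[OF that(1)] that assms(6) unfolding complete_irreducibles_def by fastforce
    have irrZ: "irreducible_representation S mul (fst (ind k y)) (snd (ind k y))"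
      if "k \<le> n" "y \<in> Y k" for k y
      unfolding ind_def using d_class.irreducible_induced[OF p irrY] that by simp
    \<comment> \<open>Completeness counts elements of \<open>Z\<close>, so equality is required.
      Equivalence first forces \<open>k = k'\<close> and then an equivalence over the group, of
      whose class \<open>Y k\<close> has only one member.\<close>
    have unique: "ind k y = ind k' y'"
      if k: "k \<le> n" "y \<in> Y k" and k': "k' \<le> n" "y' \<in> Y k'"
        and eq: "equivalent_representations S (ind k y) (ind k' y')" for k k' y y'
    proof -
      have "isomorphic_idempotents S mul (e k) (e k')"
        using eq unfolding ind_def
        by (intro induced_equivalent_isomorphic[OF p[OF k(1)] p[OF k'(1)] irrY[OF k] irrY[OF k']]) simp
      hence kk: "k' = k" using iso_eq k k' by metis
      have eq': "equivalent_representations (maximal_subgroup S mul (e k)) (fst y, snd y) (fst y', snd y')"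
        using eq unfolding ind_def kk
        by (intro d_class.induced_equivalent_imp[OF p[OF k(1)] irrY[OF k] irrY[OF k'[unfolded kk]]]) simp
      have refl: "equivalent_representations (maximal_subgroup S mul (e k)) (fst y, snd y) (fst y, snd y)"
        by (rule equivalent_representations_refl[OF irr_rep[OF irrY[OF k]]])
          (rule d_class.finite_G[OF p[OF k(1)]])
      have "\<exists>!x. x \<in> Y k \<and> equivalent_representations (maximal_subgroup S mul (e k)) (fst y, snd y) x"
        using Y[OF k(1)] irrY[OF k] assms(6)[OF k(1)] unfolding complete_irreducibles_def by metis
      hence "y = y'" using eq' refl k(2) k'(2) kk by auto
      thus ?thesis by (simp add: kk)
    qed
    have Z: "complete_irreducibles S mul Z"
      unfolding complete_irreducibles_def
    proof (intro conjI allI impI)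
      show "\<forall>(d, \<rho>)\<in>Z. irreducible_representation S mul d \<rho>"
      proof
        fix z assume "z \<in> Z"
        then obtain k y where "k \<le> n" "y \<in> Y k" "z = ind k y" by (auto simp: Z_def)
        thus "case z of (d, \<rho>) \<Rightarrow> irreducible_representation S mul d \<rho>"
          using irrZ[of k y] by (simp add: case_prod_unfold)
      qed
      fix d \<sigma> assume irr: "irreducible_representation S mul d \<sigma>"
      obtain a where a: "a \<in> idempotents S mul"
        and min: "\<And>b. isomorphic_idempotents S mul a b \<Longrightarrow> \<sigma> (point_mass b) \<noteq> 0\<^sub>m d d"
          "\<And>b f. isomorphic_idempotents S mul a b \<Longrightarrow> f \<in> idempotents S mul \<Longrightarrow> rank f < rank b \<Longrightarrow>
            \<sigma> (point_mass f) = 0\<^sub>m d d"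
        using irreducible_minimal_idempotent[OF fin irr] by blast
      \<comment> \<open>The minimal idempotent \<open>a\<close> need not be a chosen one; its
        minimality is transferred to the representative \<open>e k\<close> of its D-class.\<close>
      have "green_D S mul `` {a} \<in> D_classes S mul"
        using a by (auto simp: D_classes_def intro: quotientI idem_in)
      then obtain k where k: "k \<le> n" and "D k = green_D S mul `` {a}"
        using bij_betw_imp_surj_on[OF assms(3)] by (metis atLeastAtMost_iff imageE)
      hence iso: "isomorphic_idempotents S mul a (e k)"
        using assms(5)[OF k] by (simp add: green_idem_iff[OF a eE[OF k]])
      have "\<exists>(d', \<rho>)\<in>Y k. equivalent_representations S (d, \<sigma>)
          (r k * d', d_class.induced_representation S mul (e k) (r k) (p k) d' \<rho>)"
        using min[OF iso] Y[OF k] unfolding assms(6)[OF k]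
        by (intro d_class.irreducible_equivalent_induced[OF p[OF k] irr]) blast+
      then obtain y where y: "y \<in> Y k" "equivalent_representations S (d, \<sigma>) (ind k y)"
        by (auto simp: ind_def)
      show "\<exists>!z. z \<in> Z \<and> equivalent_representations S (d, \<sigma>) z"
      proof (rule ex1I[of _ "ind k y"])
        show "ind k y \<in> Z \<and> equivalent_representations S (d, \<sigma>) (ind k y)"
          using y k by (auto simp: Z_def)
        fix z assume z: "z \<in> Z \<and> equivalent_representations S (d, \<sigma>) z"
        then obtain k' y' where k': "k' \<le> n" "y' \<in> Y k'" and zi: "z = ind k' y'" by (auto simp: Z_def)
        have "equivalent_representations S (ind k' y') (ind k y)"
          using equivalent_representations_common[OF fin irr irrZ[OF k'] irrZ[OF k y(1)]]
            z y(2) by (simp add: zi)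
        thus "z = ind k y" unfolding zi by (rule unique[OF k' k y(1)])
      qed
    qed

    \<comment> \<open>One run of the group program \<open>Q k\<close> for each pair of blocks, which
      is where the factor \<open>(r k)\<^sup>2\<close> comes from.\<close>
    define C where "C = (SIGMA k:{0..n}. {0..<r k} \<times> {0..<r k})"
    define F where "F = (\<lambda>(k, a, b) h x. zeta_transform S mul x
      (mul (mul (p k a) h) (sinv S mul (p k b))))"
    have slpP: "straight_line_program S P"
      and zP: "\<And>s. s \<in> S \<Longrightarrow> computable S P (\<lambda>x. zeta_transform S mul x s)"
      using P by (auto simp: computes_iff)
    have F: "computable S P (F c h)" if "c \<in> C" "h \<in> G (fst c)" for c h
    proof -
      obtain k a b where c: "c = (k, a, b)" by (cases c)
      have k: "k \<le> n" "a < r k" "b < r k" using that(1) by (auto simp: C_def c)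
      have "h \<in> maximal_subgroup S mul (e k)" using that(2) assms(6)[OF k(1)] by (simp add: c)
      hence "mul (mul (p k a) h) (sinv S mul (p k b)) \<in> S"
        using d_class.coord_unit_in(1)[OF p[OF k(1)] k(2,3)] by simp
      thus ?thesis using zP by (simp add: F_def c)
    qed
    have "finite C" by (simp add: C_def)
    moreover have "straight_line_program (G (fst c)) (Q (fst c))" if "c \<in> C" for c
      using that Q[of "fst c"] by (auto simp: C_def computes_iff)
    ultimately obtain R where slpR: "straight_line_program S R"
      and lenR: "length R = length P + (\<Sum>c\<in>C. length (Q (fst c)))"
      and R: "\<And>c \<phi>. c \<in> C \<Longrightarrow> computable (G (fst c)) (Q (fst c)) \<phi> \<Longrightarrow>
        computable S R (\<lambda>x. \<phi> (\<lambda>h. F c h x))"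
      using compose_program_family[OF slpP, of C "\<lambda>c. G (fst c)" "\<lambda>c. Q (fst c)" F] F by metis
    have "computes S {(z, i, j). z \<in> Z \<and> i < fst z \<and> j < fst z}
        (\<lambda>f (z, i, j). fourier_transform S f z $$ (i, j)) R"
      unfolding computes_iff
    proof (intro conjI slpR ballI, clarify)
      fix d \<sigma> i j assume "(d, \<sigma>) \<in> Z" and ij: "i < fst (d, \<sigma>)" "j < fst (d, \<sigma>)"
      \<comment> \<open>Any \<open>k\<close> and \<open>y\<close> that produce this member of
        \<open>Z\<close> will do, since each entry only has to be available somewhere in
        \<open>R\<close>.\<close>
      then obtain k y where k: "k \<le> n" and y: "y \<in> Y k" and z: "(d, \<sigma>) = ind k y"
        by (auto simp: Z_def)
      define d' \<rho> where "d' = fst y" and "\<rho> = snd y"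
      have y': "y = (d', \<rho>)" by (simp add: d'_def \<rho>_def)
      have ij': "i < r k * d'" "j < r k * d'" using ij z by (auto simp: ind_def y')
      hence d': "0 < d'" by (cases d') auto
      let ?c = "(k, i div d', j div d')"
      have c: "?c \<in> C" using ij' k by (auto simp: C_def less_mult_imp_div_less)
      have m: "(y, i mod d', j mod d') \<in> {(y, i, j). y \<in> Y k \<and> i < fst y \<and> j < fst y}"
        using y d' by (simp add: y')
      have "computable (G k) (Q k) (\<lambda>f. fourier_transform (G k) f y $$ (i mod d', j mod d'))"
        using bspec[OF conjunct2[OF Q[OF k, unfolded computes_iff]] m] by simp
      hence "computable S R (\<lambda>x. fourier_transform (G k) (\<lambda>h. F ?c h x) y $$ (i mod d', j mod d'))"
        using R[OF c] by simp
      moreover have "fourier_transform S x (ind k y) $$ (i, j)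
          = fourier_transform (G k) (\<lambda>h. F ?c h x) y $$ (i mod d', j mod d')" for x
        using d_class.fourier_transform_induced[OF p[OF k] ij'] assms(6)[OF k]
        by (simp add: ind_def y' F_def)
      ultimately show "computable S R (\<lambda>f. fourier_transform S f (d, \<sigma>) $$ (i, j))"
        by (simp add: z)
    qed
    hence "fourier_complexity_wrt S Z \<le> enat (length R)"
      unfolding fourier_complexity_wrt_def by (rule operation_count_le)
    moreover have "fourier_complexity S mul \<le> fourier_complexity_wrt S Z"
      unfolding fourier_complexity_def using Z by (intro INF_lower) simp
    moreover have "(\<Sum>c\<in>C. length (Q (fst c))) = (\<Sum>k=0..n. (r k)\<^sup>2 * length (Q k))"
    proof -
      have "(\<Sum>c\<in>C. length (Q (fst c))) = (\<Sum>(k, _)\<in>C. length (Q k))"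
        by (simp add: case_prod_unfold)
      also have "\<dots> = (\<Sum>k=0..n. \<Sum>_\<in>{0..<r k} \<times> {0..<r k}. length (Q k))"
        unfolding C_def by (rule sum.Sigma[symmetric]) auto
      finally show ?thesis by (simp add: power2_eq_square)
    qed
    moreover have "enat (\<Sum>k=0..n. (r k)\<^sup>2 * length (Q k))
        = (\<Sum>k=0..n. enat ((r k)\<^sup>2) * fourier_complexity (G k) mul)"
      by (simp add: len flip: of_nat_eq_enat)
    ultimately show ?thesis
      by (simp add: lenR lenP flip: plus_enat_simps(1))
  qed
qed

end
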